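(* Let $(X_i,Y_i)_{i=1}^n$ be i.i.d. samples with $X_i\in\mathbb{R}^d$ and $Y_i\in\mathbb{R}$, and assume the following. (A1) Ridge-structured regression function. There exist a matrix $U\in\mathbb{R}^{d\times r}$ with orthonormal columns, $r\le d$, and a function $g:\mathbb{R}^r\to\mathbb{R}$ such that $f(x):=\mathbb{E}[Y\mid X=x]=g(U^\top x)$. (A2) Regularity. The support of $X$ is contained in a compact set $\mathcal{X}\subset\mathbb{R}^d$ with $\|x\|_2\le R$ for all $x\in\mathcal{X}$. The function $g$ is $L$-Lipschitz on $U^\top\mathcal{X}$, and $Y=f(X)+\xi$ with $\mathbb{E}[\xi\mid X]=0$ and $\mathbb{E}[\xi^2]\le\sigma^2$. (A3) EJOP structure. Let $H_0=\mathbb{E}[\nabla f(X)\nabla f(X)^\top]$. Then $\mathrm{rank}(H_0)=r$, and there is a spectral gap $\lambda_r(H_0)\ge\lambda_{\min}>0$ between the $r$-th and $(r+1)$-st eigenvalues. (A4) EJOP estimation. Let $\hat H$ be the EJOP estimator used by JARF, constructed from a surrogate forest and finite differences (defined in the context). There exist a sequence $\varepsilon_n\to0$ and failure probabilities $\delta_n\to0$ such that $$\|\hat H-H_0\|_{\mathrm{op}}\le\varepsilon_n\quad\text{with probability at least }1-\delta_n.$$ (A5) Regressor consistency in fixed dimension. Let $\hat U\in\mathbb{R}^{d\times r}$ be the matrix of top $r$ eigenvectors of $\hat H$, and let $Z_i=\hat U^\top X_i\in\mathbb{R}^r$ and $Z=\hat U^\top X$. Let $m_{\hat U}(z):=\mathbb{E}[Y\mid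 Z=z]$ be the regression function in the projected space, and assume $m_{\hat U}$ is $L_Z$-Lipschitz on the support of $Z$, for some constant $L_Z$ that does not depend on $d$ or $n$. Let $\hat f_n$ be the regression estimator used by JARF, trained on $(Z_i,Y_i)_{i=1}^n$ (a regression forest with tree depth and leaf size chosen as in standard consistency results for forests in $r$ dimensions). Assume that there exists a constant $c_1$ such that $$\mathbb{E}\big[(\hat f_n(Z)-m_{\hat U}(Z))^2\,\big|\,\hat U\big]\;\le\;c_1\,n^{-\frac{2}{2+r}}+o(1)$$ for every realization of $\hat U$ with orthonormal columns. Then there exist constants $C_1,C_2>0$, independent of $d$, such that $$\mathbb{E}\big[(\hat f_n(X)-f(X))^2\big]\;\le\;C_1\,n^{-\frac{2}{2+r}}+C_2\,\varepsilon_n^2+o(1),$$ where $\hat f_n(X)$ means $\hat f_n(\hat U^\top X)$. In particular, when $\varepsilon_n\to0$ sufficiently fast, JARF attains the usual nonparametric rate in dimension $r$, up to negligible terms, even though the data live in $\mathbb{R}^d$.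
   Context: $X$ without index denotes a fresh test point. Expectations in the conclusion are taken over the training sample, the fresh test point $X$, and any internal randomness of the estimator. $\lambda_k(\cdot)$ is the $k$-th largest eigenvalue and $\|\cdot\|_{\mathrm{op}}$ the operator norm; $o(1)$ is as $n\to\infty$. EJOP (expected Jacobian outer product) is, for a scalar regression function $f$, the matrix $H_0=\mathbb{E}[\nabla f(X)\nabla f(X)^\top]$. JARF (Jacobian Aligned Random Forests) is the following procedure, in the form analysed here. First fit a surrogate random forest $\hat f$ on the training data to approximate $\mathbb{E}[Y\mid X=x]$. On a subsample of $m$ training inputs form centered finite-difference gradients $G_i\in\mathbb{R}^d$ with $j$-th entry $\big(\hat f(X_i+\tfrac{h}{2}e_j)-\hat f(X_i-\tfrac{h}{2}e_j)\big)/h$, where $h>0$ is a step size and $e_j$ is the $j$-th standard basis vector, and set $\hat H=\frac1m\sum_{i=1}^m G_iG_i^\top$. Then project the inputs onto the top $r$ eigenvectors of $\hat H$ and train the final regressor $\hat f_n$ (a standard axis-aligned forest) on the projected features $Z_i=\hat U^\top X_i$. *)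

theory Defs
  imports
    "HOL-Probability.Probability"
    "HOL-Library.Tree"
    "Jordan_Normal_Form.Char_Poly"
    "Jordan_Normal_Form.DL_Rank"
begin

section \<open>Euclidean spaces of variable dimension\<close>

text \<open>
  The dimension must be a value, not a type, because the constants of the theorem are chosen before
  the ambient dimension. A point of p-dimensional space is an extensional function on \<open>{..<p}\<close>, so
  coordinates are counted from 0. Matrices are those of the Jordan normal form library.
\<close>

abbreviation Rsp :: "nat \<Rightarrow> (nat \<Rightarrow> real) measure" where
  "Rsp p \<equiv> PiM {..<p} (\<lambda>_. borel)"

definition l2dist :: "nat \<Rightarrow> (nat \<Rightarrow> real) \<Rightarrow> (nat \<Rightarrow> real) \<Rightarrow> real" where
  "l2dist p x y = L2_set (\<lambda>i. x i - y i) {..<p}"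

definition l2_lipschitz_on :: "nat \<Rightarrow> real \<Rightarrow> (nat \<Rightarrow> real) set \<Rightarrow> ((nat \<Rightarrow> real) \<Rightarrow> real) \<Rightarrow> bool" where
  "l2_lipschitz_on p L A g \<longleftrightarrow>
     0 \<le> L \<and> (\<forall>x\<in>A. \<forall>y\<in>A. \<bar>g x - g y\<bar> \<le> L * l2dist p x y)"

text \<open>The Frechet derivative at \<open>x\<close>, represented by the vector \<open>v\<close>.\<close>

definition has_gradient ::
  "nat \<Rightarrow> ((nat \<Rightarrow> real) \<Rightarrow> real) \<Rightarrow> (nat \<Rightarrow> real) \<Rightarrow> (nat \<Rightarrow> real) \<Rightarrow> bool" where
  "has_gradient p f x v \<longleftrightarrow> v \<in> space (Rsp p) \<and>
     (\<forall>e>0. \<exists>\<delta>>0. \<forall>y\<in>space (Rsp p). l2dist p y x < \<delta> \<longrightarrow>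
        \<bar>f y - f x - (\<Sum>i<p. v i * (y i - x i))\<bar> \<le> e * l2dist p y x)"

definition gradient :: "nat \<Rightarrow> ((nat \<Rightarrow> real) \<Rightarrow> real) \<Rightarrow> (nat \<Rightarrow> real) \<Rightarrow> (nat \<Rightarrow> real)" where
  "gradient p f x = (THE v. has_gradient p f x v)"

text \<open>\<open>proj A x\<close> is the product of the transpose of \<open>A\<close> with \<open>x\<close>.\<close>

definition proj :: "real mat \<Rightarrow> (nat \<Rightarrow> real) \<Rightarrow> (nat \<Rightarrow> real)" where
  "proj A x = (\<lambda>k\<in>{..<dim_col A}. \<Sum>i<dim_row A. A $$ (i, k) * x i)"

definition orthonormal_columns :: "nat \<Rightarrow> nat \<Rightarrow> real mat \<Rightarrow> bool" where
  "orthonormal_columns d r A \<longleftrightarrow> A \<in> carrier_mat d r \<and> transpose_mat A * A = 1\<^sub>m r"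

definition op_norm :: "real mat \<Rightarrow> real" where
  "op_norm A = (SUP x\<in>{x \<in> carrier_vec (dim_col A). x \<bullet> x \<le> 1}.
     sqrt ((A *\<^sub>v x) \<bullet> (A *\<^sub>v x)))"

text \<open>
  The \<open>k\<close>-th largest eigenvalue, \<open>k \<ge> 1\<close>, counted with multiplicity; used for symmetric matrices,
  all of whose characteristic roots are real.
\<close>

definition kth_eigenvalue :: "nat \<Rightarrow> real mat \<Rightarrow> real" where
  "kth_eigenvalue k A = rev (sorted_list_of_multiset (proots (char_poly A))) ! (k - 1)"

definition top_eigenvectors :: "nat \<Rightarrow> nat \<Rightarrow> real mat \<Rightarrow> real mat \<Rightarrow> bool" where
  "top_eigenvectors d r A V \<longleftrightarrow> orthonormal_columns d r V \<and>
     (\<forall>k<r. eigenvector A (col V k) (kth_eigenvalue (k + 1) A))"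

definition mat_space :: "nat \<Rightarrow> nat \<Rightarrow> real mat measure" where
  "mat_space d r = vimage_algebra (carrier_mat d r)
     (\<lambda>A. \<lambda>ij\<in>{..<d} \<times> {..<r}. A $$ ij) (PiM ({..<d} \<times> {..<r}) (\<lambda>_. borel))"


section \<open>Probabilistic notions\<close>

definition law_support :: "'w measure \<Rightarrow> nat \<Rightarrow> ('w \<Rightarrow> nat \<Rightarrow> real) \<Rightarrow> (nat \<Rightarrow> real) set" where
  "law_support M p V = {z \<in> space (Rsp p).
     \<forall>\<rho>>0. 0 < measure M {\<omega> \<in> space M. l2dist p (V \<omega>) z < \<rho>}}"

text \<open>\<open>m\<close> is a version of the map sending \<open>x\<close> to the conditional mean of \<open>T\<close> given \<open>V = x\<close>.\<close>

definition regression_function ::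
  "'w measure \<Rightarrow> 'v measure \<Rightarrow> ('w \<Rightarrow> 'v) \<Rightarrow> ('w \<Rightarrow> real) \<Rightarrow> ('v \<Rightarrow> real) \<Rightarrow> bool" where
  "regression_function M N V T m \<longleftrightarrow>
     V \<in> measurable M N \<and> integrable M T \<and> m \<in> borel_measurable N \<and>
     (AE \<omega> in M. m (V \<omega>) = real_cond_exp M (vimage_algebra (space M) V N) T \<omega>)"

text \<open>
  \<open>(X i, Y i)\<close> for \<open>i \<ge> 1\<close> are the training pairs and \<open>(X 0, Y 0)\<close> is the fresh test pair. All
  internal randomness of the procedure is carried by the seed \<open>S\<close>, which takes values in \<open>Q\<close>.
\<close>

definition iid_regression_data ::
  "'w measure \<Rightarrow> 's measure \<Rightarrow> nat \<Rightarrow> (nat \<Rightarrow> 'w \<Rightarrow> nat \<Rightarrow> real) \<Rightarrow> (nat \<Rightarrow> 'w \<Rightarrow> real) \<Rightarrow>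
   ('w \<Rightarrow> 's) \<Rightarrow> bool" where
  "iid_regression_data M Q d X Y S \<longleftrightarrow>
     prob_space M \<and>
     prob_space.indep_vars M (\<lambda>_. Rsp d \<Otimes>\<^sub>M borel) (\<lambda>i \<omega>. (X i \<omega>, Y i \<omega>)) UNIV \<and>
     (\<forall>i. distr M (Rsp d \<Otimes>\<^sub>M borel) (\<lambda>\<omega>. (X i \<omega>, Y i \<omega>))
        = distr M (Rsp d \<Otimes>\<^sub>M borel) (\<lambda>\<omega>. (X 0 \<omega>, Y 0 \<omega>))) \<and>
     S \<in> measurable M Q \<and>
     prob_space.indep_set M
       (sets (vimage_algebra (space M) (\<lambda>\<omega> i. (X i \<omega>, Y i \<omega>)) (PiM UNIV (\<lambda>_. Rsp d \<Otimes>\<^sub>M borel))))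
       (sets (vimage_algebra (space M) S Q))"

text \<open>The sigma-algebra generated by \<open>(V 1, Y 1), \<dots>, (V n, Y n)\<close> and the seed.\<close>

definition training_algebra ::
  "'w measure \<Rightarrow> 's measure \<Rightarrow> ('w \<Rightarrow> 's) \<Rightarrow> nat \<Rightarrow> nat \<Rightarrow> (nat \<Rightarrow> 'w \<Rightarrow> nat \<Rightarrow> real) \<Rightarrow>
   (nat \<Rightarrow> 'w \<Rightarrow> real) \<Rightarrow> 'w measure" where
  "training_algebra M Q S p n V Y = vimage_algebra (space M)
     (\<lambda>\<omega>. (\<lambda>i\<in>{1..n}. (V i \<omega>, Y i \<omega>), S \<omega>)) (PiM {1..n} (\<lambda>_. Rsp p \<Otimes>\<^sub>M borel) \<Otimes>\<^sub>M Q)"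

text \<open>The expected Jacobian outer product of \<open>f\<close> under the law of \<open>V\<close>, and the conditions for it to
  exist.\<close>

definition ejop ::
  "'w measure \<Rightarrow> nat \<Rightarrow> ((nat \<Rightarrow> real) \<Rightarrow> real) \<Rightarrow> ('w \<Rightarrow> nat \<Rightarrow> real) \<Rightarrow> real mat" where
  "ejop M d f V = Matrix.mat d d
     (\<lambda>(j, k). integral\<^sup>L M (\<lambda>\<omega>. gradient d f (V \<omega>) j * gradient d f (V \<omega>) k))"

definition ejop_exists ::
  "'w measure \<Rightarrow> nat \<Rightarrow> ((nat \<Rightarrow> real) \<Rightarrow> real) \<Rightarrow> ('w \<Rightarrow> nat \<Rightarrow> real) \<Rightarrow> bool" where
  "ejop_exists M d f V \<longleftrightarrow>
     (AE \<omega> in M. \<exists>v. has_gradient d f (V \<omega>) v) \<and>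
     (\<forall>j<d. \<forall>k<d. integrable M (\<lambda>\<omega>. gradient d f (V \<omega>) j * gradient d f (V \<omega>) k))"


section \<open>Axis-aligned regression forests\<close>

text \<open>
  An inner node \<open>(j, s)\<close> sends \<open>x\<close> to the left subtree iff \<open>x j \<le> s\<close>. The leaf reached by \<open>x\<close> is
  identified by the path leading to it.
\<close>

fun leaf_of :: "(nat \<times> real) tree \<Rightarrow> (nat \<Rightarrow> real) \<Rightarrow> bool list" where
  "leaf_of Leaf x = []"
| "leaf_of (Node l js t) x =
     (if x (fst js) \<le> snd js then True # leaf_of l x else False # leaf_of t x)"

text \<open>The weight \<open>w i\<close> is the multiplicity of training point \<open>i\<close> in the (bootstrap or
  subsampled) training set of the tree.\<close>

definition leaf_count ::
  "(nat \<times> real) tree \<Rightarrow> (nat \<Rightarrow> nat) \<Rightarrow> nat \<Rightarrow> (nat \<Rightarrow> nat \<Rightarrow> real) \<Rightarrow> (nat \<Rightarrow> real) \<Rightarrow> nat" where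
  "leaf_count t w n xs x = (\<Sum>i\<in>{1..n}. if leaf_of t (xs i) = leaf_of t x then w i else 0)"

text \<open>The average response over the leaf of \<open>x\<close>, and 0 if that leaf is empty.\<close>

definition tree_predict ::
  "(nat \<times> real) tree \<Rightarrow> (nat \<Rightarrow> nat) \<Rightarrow> nat \<Rightarrow> (nat \<Rightarrow> nat \<Rightarrow> real) \<Rightarrow> (nat \<Rightarrow> real) \<Rightarrow>
   (nat \<Rightarrow> real) \<Rightarrow> real" where
  "tree_predict t w n xs ys x =
     (\<Sum>i\<in>{1..n}. if leaf_of t (xs i) = leaf_of t x then real (w i) * ys i else 0)
       / real (leaf_count t w n xs x)"

text \<open>
  \<open>F\<close> is the prediction of some forest on \<open>p\<close>-dimensional data whose trees have depth at most
  \<open>depth\<close> and at least \<open>leafsize\<close> training points in every leaf; the split rule is unrestricted.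
\<close>

definition regression_forest ::
  "nat \<Rightarrow> nat \<Rightarrow> nat \<Rightarrow> nat \<Rightarrow> (nat \<Rightarrow> nat \<Rightarrow> real) \<Rightarrow> (nat \<Rightarrow> real) \<Rightarrow>
   ((nat \<Rightarrow> real) \<Rightarrow> real) \<Rightarrow> bool" where
  "regression_forest p n depth leafsize xs ys F \<longleftrightarrow>
     (\<exists>B\<ge>1. \<exists>(t :: nat \<Rightarrow> (nat \<times> real) tree) (w :: nat \<Rightarrow> nat \<Rightarrow> nat).
        (\<forall>b<B. fst ` set_tree (t b) \<subseteq> {..<p} \<and> height (t b) \<le> depth \<and>
           (\<forall>x\<in>space (Rsp p). leafsize \<le> leaf_count (t b) (w b) n xs x)) \<and>
        (\<forall>x\<in>space (Rsp p). F x = (\<Sum>b<B. tree_predict (t b) (w b) n xs ys x) / real B))"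

text \<open>A random forest fitted to the first \<open>n\<close> training pairs \<open>(V i, Y i)\<close> with the help of the
  seed, hence a function of these alone.\<close>

definition forest_estimator ::
  "'w measure \<Rightarrow> 's measure \<Rightarrow> ('w \<Rightarrow> 's) \<Rightarrow> nat \<Rightarrow> nat \<Rightarrow> nat \<Rightarrow> nat \<Rightarrow>
   (nat \<Rightarrow> 'w \<Rightarrow> nat \<Rightarrow> real) \<Rightarrow> (nat \<Rightarrow> 'w \<Rightarrow> real) \<Rightarrow> ('w \<Rightarrow> (nat \<Rightarrow> real) \<Rightarrow> real) \<Rightarrow> bool" where
  "forest_estimator M Q S p n depth leafsize V Y F \<longleftrightarrow>
     (\<forall>\<omega>\<in>space M. regression_forest p n depth leafsize (\<lambda>i. V i \<omega>) (\<lambda>i. Y i \<omega>) (F \<omega>)) \<and>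
     (\<lambda>(\<omega>, x). F \<omega> x) \<in> borel_measurable (training_algebra M Q S p n V Y \<Otimes>\<^sub>M Rsp p)"


section \<open>The EJOP estimator\<close>

definition fd_gradient ::
  "nat \<Rightarrow> real \<Rightarrow> ((nat \<Rightarrow> real) \<Rightarrow> real) \<Rightarrow> (nat \<Rightarrow> real) \<Rightarrow> (nat \<Rightarrow> real)" where
  "fd_gradient d h F x = (\<lambda>j\<in>{..<d}. (F (x(j := x j + h / 2)) - F (x(j := x j - h / 2))) / h)"

definition ejop_estimate ::
  "nat \<Rightarrow> real \<Rightarrow> ((nat \<Rightarrow> real) \<Rightarrow> real) \<Rightarrow> (nat \<Rightarrow> nat \<Rightarrow> real) \<Rightarrow> nat set \<Rightarrow> real mat" where
  "ejop_estimate d h F xs J = Matrix.mat d d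
     (\<lambda>(j, k). (\<Sum>i\<in>J. fd_gradient d h F (xs i) j * fd_gradient d h F (xs i) k) / real (card J))"

end

theory Submission
  imports Defs
begin

text \<open>
  By independence of the fresh point \<open>X\<close> and the training data, the error of \<open>m\<close> at the estimated
  subspace \<open>V\<close> is the mean over the training sample of \<open>E (m\<^sub>V (V\<^sup>T X) - f X)\<^sup>2\<close>. Conditional
  expectation is the best approximation in mean square, so \<open>m\<^sub>V\<close> may be replaced by
  \<open>z \<mapsto> g (U\<^sup>T V z)\<close>, with \<open>g\<close> extended as in McShane's theorem; this costs at most
  \<open>L\<^sup>2 R\<^sup>2 (r - \<parallel>U\<^sup>T V\<parallel>\<^sup>2)\<close> in Frobenius norm. As \<open>f\<close> is a ridge function, \<open>H\<^sub>0\<close> vanishes on the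
  complement of the columns of \<open>U\<close>, and an eigenvector \<open>v\<close> of the estimate of \<open>H\<^sub>0\<close> with eigenvalue
  \<open>\<lambda>\<close> satisfies \<open>\<lambda> \<parallel>(I - U U\<^sup>T) v\<parallel> \<le> \<epsilon>\<close>. Weyl's inequality gives \<open>\<lambda> \<ge> \<lambda>\<^sub>m\<^sub>i\<^sub>n - \<epsilon>\<close> for
  the top \<open>r\<close> eigenvalues, hence the bound \<open>r (\<epsilon> / (\<lambda>\<^sub>m\<^sub>i\<^sub>n - \<epsilon>))\<^sup>2\<close> off an event of probability
  \<open>\<delta>\<close>, where the trivial bound \<open>r\<close> is used.

  Since \<open>\<epsilon>\<close> and the rate tend to 0, the risk tends to 0, so the risk itself can serve as the
  \<open>o(1)\<close> term and any positive \<open>C\<^sub>1\<close>, \<open>C\<^sub>2\<close> will do.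
\<close>

text \<open>This frees the symbol \<bullet> for the scalar product of the vectors of variable
  dimension.\<close>

unbundle no inner_syntax


section \<open>Spectral theory of real symmetric matrices\<close>

text \<open>For an eigenvector \<open>v\<close>, moving the real symmetric \<open>A\<close> from one
  factor of \<open>v \<bullet> conjugate v\<close> to the other turns the factor \<open>a\<close>
  into \<open>cnj a\<close>, and the product itself is nonzero.\<close>

lemma eigenvalue_real_if_symmetric:
  fixes A :: "real mat"
  assumes A: "A \<in> carrier_mat n n" and sym: "transpose_mat A = A"
    and ev: "eigenvalue (map_mat complex_of_real A) a"
  shows "a \<in> \<real>"
proof -
  let ?A = "map_mat complex_of_real A"
  have A': "?A \<in> carrier_mat n n" using A by auto
  from ev obtain v where v: "v \<in> carrier_vec n" "v \<noteq> 0\<^sub>v n" and eq: "?A *\<^sub>v v = a \<cdot>\<^sub>v v"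
    using A unfolding eigenvalue_def eigenvector_def by auto
  have symA: "transpose_mat ?A = ?A" using sym A by (metis map_mat_transpose)
  have cv: "conjugate v \<in> carrier_vec n" using v by simp
  have conj_eq: "?A *\<^sub>v conjugate v = conjugate (?A *\<^sub>v v)"
  proof (rule eq_vecI)
    fix i assume "i < dim_vec (conjugate (?A *\<^sub>v v))"
    then have i: "i < n" using A by simp
    show "(?A *\<^sub>v conjugate v) $ i = conjugate (?A *\<^sub>v v) $ i"
      using i A v by (simp add: scalar_prod_def cnj_sum)
  qed (use A in simp)
  have "a * (v \<bullet> conjugate v) = (?A *\<^sub>v v) \<bullet> conjugate v"
    unfolding eq using v cv by simp
  also have "\<dots> = v \<bullet> (?A *\<^sub>v conjugate v)"
    using transpose_vec_mult_scalar[OF A' cv v(1)] symA by simp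
  also have "\<dots> = cnj a * (v \<bullet> conjugate v)"
    unfolding conj_eq eq using v cv by (simp add: conjugate_smult_vec)
  finally have "a * (v \<bullet> conjugate v) = cnj a * (v \<bullet> conjugate v)" .
  moreover have "v \<bullet> conjugate v \<noteq> 0" using conjugate_square_eq_0_vec[OF v(1)] v(2) by simp
  ultimately have "a = cnj a" by simp
  then show ?thesis using Reals_cnj_iff by metis
qed

text \<open>The polynomial splits over the complex numbers. Its roots are eigenvalues, hence real,
  so the factorization is the image of a real one; embedding real polynomials is injective on
  coefficients.\<close>

lemma char_poly_splits_if_symmetric:
  fixes A :: "real mat"
  assumes A: "A \<in> carrier_mat n n" and sym: "transpose_mat A = A"
  shows "\<exists>es. char_poly A = (\<Prod>e\<leftarrow>es. [:- e, 1:]) \<and> length es = n"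
proof -
  let ?A = "map_mat complex_of_real A"
  have A': "?A \<in> carrier_mat n n" using A by auto
  from char_poly_factorized[OF A'] obtain as where
    cp: "char_poly ?A = (\<Prod>a\<leftarrow>as. [:- a, 1:])" and len: "length as = n" by auto
  have re: "a = complex_of_real (Re a)" if "a \<in> set as" for a
  proof -
    have "poly (char_poly ?A) a = 0"
      unfolding cp using that by (simp add: poly_prod_list image_iff)
    then have "eigenvalue ?A a" using eigenvalue_root_char_poly[OF A'] by simp
    from eigenvalue_real_if_symmetric[OF A sym this] show ?thesis by simp
  qed
  have map_prod: "map_poly complex_of_real (\<Prod>e\<leftarrow>es. [:- e, 1:])
      = (\<Prod>e\<leftarrow>es. [:- complex_of_real e, 1:])" for es
  proof (induction es)
    case (Cons e es)
    interpret h: map_poly_comm_ring_hom complex_of_real ..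
    have "map_poly complex_of_real ([:- e, 1:] * (\<Prod>e\<leftarrow>es. [:- e, 1:]))
      = map_poly complex_of_real [:- e, 1:] * map_poly complex_of_real (\<Prod>e\<leftarrow>es. [:- e, 1:])"
      by (rule h.hom_mult)
    with Cons show ?case by (simp add: map_poly_pCons)
  qed simp
  have "map_poly complex_of_real (char_poly A) = char_poly ?A"
    by (rule of_real_hom.char_poly_hom[OF A, symmetric])
  also have "\<dots> = (\<Prod>a\<leftarrow>as. [:- complex_of_real (Re a), 1:])"
    unfolding cp using re by (intro arg_cong[where f = prod_list] map_cong) auto
  also have "\<dots> = map_poly complex_of_real (\<Prod>e\<leftarrow>map Re as. [:- e, 1:])"
    unfolding map_prod by (simp add: o_def)
  finally have "map_poly complex_of_real (char_poly A) =
    map_poly complex_of_real (\<Prod>e\<leftarrow>map Re as. [:- e, 1:])" .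
  then have "char_poly A = (\<Prod>e\<leftarrow>map Re as. [:- e, 1:])"
    by (metis (no_types, lifting) of_real_eq_iff  poly_eq_iff coeff_map_poly of_real_0)
  then show ?thesis using len by (intro exI[of _ "map Re as"]) simp
qed

text \<open>The reflection that exchanges \<open>v\<close> with the first unit vector. It takes the
  place of completing \<open>v\<close> to an orthonormal basis by the Gram-Schmidt process.\<close>

lemma householder:
  fixes v :: "real vec"
  assumes v: "v \<in> carrier_vec n" and unit: "v \<bullet> v = 1" and n: "0 < n"
  obtains W where "W \<in> carrier_mat n n" "transpose_mat W = W" "W * W = 1\<^sub>m n" "col W 0 = v"
proof -
  define w where "w = v - unit_vec n 0"
  \<comment> \<open>if \<open>v\<close> is already the first unit vector, division by 0 gives \<open>\<beta> = 0\<close> and \<open>W\<close> is the identity\<close>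
  define \<beta> where "\<beta> = 2 / (w \<bullet> w)"
  define W where "W = Matrix.mat n n (\<lambda>(i, j). (if i = j then 1 else 0) - \<beta> * w $ i * w $ j)"
  have w: "w \<in> carrier_vec n" using v unfolding w_def by simp
  have ww: "w \<bullet> w = (\<Sum>k<n. w $ k * w $ k)"
    using w by (simp add: scalar_prod_def atLeast0LessThan)
  have \<beta>: "\<beta> * (\<beta> * (w \<bullet> w)) = 2 * \<beta>" unfolding \<beta>_def by simp
  have v1: "(\<Sum>k<n. v $ k * v $ k) = 1"
    using unit v by (simp add: scalar_prod_def atLeast0LessThan)
  have wi: "w $ i = v $ i - (if i = 0 then 1 else 0)" if "i < n" for i
    using that v unfolding w_def by simp
  \<comment> \<open>Because \<open>v\<close> has norm 1, \<open>w \<bullet> w\<close> is 2 - 2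
    \<open>v $ 0\<close>, that is, -2 \<open>w $ 0\<close>. This identity makes column 0 of
    \<open>W\<close> equal to the first unit vector plus \<open>w\<close>, which is
    \<open>v\<close>.\<close>
  have "(\<Sum>k<n. w $ k * w $ k)
      = (\<Sum>k<n. v $ k * v $ k - (if k = 0 then 2 * v $ 0 - 1 else 0))"
    by (intro sum.cong refl) (auto simp: wi algebra_simps)
  also have "\<dots> = - 2 * w $ 0" using n by (simp add: sum_subtractf v1 wi sum.delta)
  finally have w0: "w \<bullet> w = - 2 * w $ 0" using ww by simp
  have \<beta>w: "\<beta> * w $ i * w $ 0 = - w $ i" if i: "i < n" for i
  proof (cases "w \<bullet> w = 0")
    case True
    have "w = 0\<^sub>v n" using True conjugate_square_eq_0_vec[OF w] by simp
    then show ?thesis using i n by simp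
  next
    case False
    then show ?thesis unfolding \<beta>_def w0 by (simp add: field_simps)
  qed
  show ?thesis
  proof
    show W: "W \<in> carrier_mat n n" unfolding W_def by simp
    show "transpose_mat W = W"
      unfolding W_def by (intro eq_matI) (auto simp: mult.commute mult.left_commute)
    show "W * W = 1\<^sub>m n"
    proof (rule eq_matI)
      fix i j assume "i < dim_row (1\<^sub>m n :: real mat)" "j < dim_col (1\<^sub>m n :: real mat)"
      then have ij: "i < n" "j < n" by auto
      have "(W * W) $$ (i, j) = (\<Sum>k<n. ((if i = k then 1 else 0) - \<beta> * w $ i * w $ k) *
          ((if k = j then 1 else 0) - \<beta> * w $ k * w $ j))"
        using ij unfolding W_def by (simp add: scalar_prod_def atLeast0LessThan)
      also have "\<dots> = (\<Sum>k<n. (if k = i then if i = j then 1 else 0 else 0)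
          - (if k = i then \<beta> * w $ i * w $ j else 0) - (if k = j then \<beta> * w $ i * w $ j else 0)
          + (\<beta> * \<beta> * w $ i * w $ j) * (w $ k * w $ k))"
        by (intro sum.cong refl) (auto simp: algebra_simps)
      also have "\<dots> = (if i = j then 1 else 0) - 2 * \<beta> * w $ i * w $ j
          + \<beta> * (\<beta> * (w \<bullet> w)) * w $ i * w $ j"
        using ij by (simp add: sum.distrib sum_subtractf ww flip: sum_distrib_left)
      also have "\<dots> = (if i = j then 1 else 0)" unfolding \<beta> by simp
      finally show "(W * W) $$ (i, j) = (1\<^sub>m n) $$ (i, j)" using ij by simp
    qed (auto simp: W_def)
    show "col W 0 = v"
      using n v \<beta>w by (intro eq_vecI) (auto simp: W_def wi)
  qed
qed


text \<open>Deflation: a Householder reflection carries a unit eigenvector for the first root to the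
  first axis. Symmetry clears the first row along with the first column, and the remaining block has
  the remaining roots. The list \<open>es\<close> may have any order, so the decreasing order of
  \<open>kth_eigenvalue\<close> can be realized.\<close>

lemma symmetric_orthogonally_diagonalizable:
  fixes A :: "real mat"
  assumes "A \<in> carrier_mat n n" "transpose_mat A = A"
    and "char_poly A = (\<Prod>e\<leftarrow>es. [:- e, 1:])"
  shows "\<exists>P \<in> carrier_mat n n. transpose_mat P * P = 1\<^sub>m n \<and>
    transpose_mat P * A * P = mat_diag n (\<lambda>i. es ! i)"
  using assms
proof (induction es arbitrary: n A)
  case Nil
  with degree_monic_char_poly[of A n] have "n = 0" by auto
  then show ?case using Nil by (intro bexI[of _ "1\<^sub>m 0"]) (auto intro!: eq_matI simp: mat_diag_def)
next
  case (Cons e es n A)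
  note A = Cons.prems(1) and sym = Cons.prems(2) and cp = Cons.prems(3)
  have len: "length (e # es) = n"
    using degree_monic_char_poly[OF A] cp degree_linear_factors[of uminus "e # es"] by simp
  define m where "m = n - 1"
  have n: "n = 1 + m" "0 < n" using len m_def by auto
  have "eigenvalue A e" unfolding eigenvalue_root_char_poly[OF A] cp by simp
  then obtain u where u: "u \<in> carrier_vec n" "u \<noteq> 0\<^sub>v n" "A *\<^sub>v u = e \<cdot>\<^sub>v u"
    using A unfolding eigenvalue_def eigenvector_def by auto
  have uu: "u \<bullet> u > 0"
    using u conjugate_square_greater_0_vec[OF u(1)] by simp
  define v where "v = (1 / sqrt (u \<bullet> u)) \<cdot>\<^sub>v u"
  have v: "v \<in> carrier_vec n" using u v_def by simp
  have vv: "v \<bullet> v = 1"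
    unfolding v_def using u uu by simp
  have Av: "A *\<^sub>v v = e \<cdot>\<^sub>v v"
    unfolding v_def using A u by (simp add: mult_mat_vec smult_smult_assoc mult.commute)
  obtain W where W: "W \<in> carrier_mat n n" "transpose_mat W = W" "W * W = 1\<^sub>m n" "col W 0 = v"
    using householder[OF v vv n(2)] .
  define A' where "A' = W * A * W"
  have A': "A' \<in> carrier_mat n n" using W A A'_def by auto
  have symA': "transpose_mat A' = A'"
    unfolding A'_def using W A sym
    by (simp add: transpose_mult[of _ n n _ n] assoc_mult_mat[of _ n n _ n _ n])
  have colA': "col A' 0 = e \<cdot>\<^sub>v unit_vec n 0"
  proof -
    have "col A' 0 = (W * A) *\<^sub>v col W 0" unfolding A'_def using W A n by (intro col_mult2) auto
    also have "\<dots> = W *\<^sub>v (A *\<^sub>v v)" using W A v by simp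
    also have "\<dots> = e \<cdot>\<^sub>v (W *\<^sub>v col W 0)" using W(1,4) v by (simp add: Av mult_mat_vec)
    also have "W *\<^sub>v col W 0 = col (W * W) 0" using W(1) n by (intro col_mult2[symmetric]) auto
    finally show ?thesis using W(3) n by simp
  qed
  have A'0: "A' $$ (i, 0) = (if i = 0 then e else 0)" if "i < n" for i
  proof -
    have "A' $$ (i, 0) = col A' 0 $ i" using that n A' by simp
    then show ?thesis using that n unfolding colA' by simp
  qed
  have A'0': "A' $$ (0, i) = (if i = 0 then e else 0)" if "i < n" for i
    using A'0[OF that] symA' A' n that by (metis carrier_matD index_transpose_mat(1))
  define A3 where "A3 = Matrix.mat m m (\<lambda>(i, j). A' $$ (i + 1, j + 1))"
  let ?E = "Matrix.mat 1 1 (\<lambda>_. e)"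
  have A3: "A3 \<in> carrier_mat m m" unfolding A3_def by simp
  have A'_block: "A' = four_block_mat ?E (0\<^sub>m 1 m) (0\<^sub>m m 1) A3"
    using A' n by (intro eq_matI) (auto simp: A'0 A'0' A3_def four_block_mat_def)
  have symA3: "transpose_mat A3 = A3"
  proof (rule eq_matI)
    fix i j assume "i < dim_row A3" "j < dim_col A3"
    then have "i < m" "j < m" using A3 by auto
    then show "transpose_mat A3 $$ (i, j) = A3 $$ (i, j)"
      unfolding A3_def using symA' A' n
      by simp (metis Suc_less_eq carrier_matD index_transpose_mat(1))
  qed (use A3 in auto)
  have "similar_mat A' A"
    unfolding similar_mat_def similar_mat_wit_def Let_def
    using W A A' by (intro exI[of _ W]) (auto simp: A'_def)
  then have "char_poly A = char_poly ?E * char_poly A3"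
    using char_poly_similar[of A' A] char_poly_four_block_zeros_col[of ?E "0\<^sub>m 1 m" m A3] A3
    unfolding A'_block by simp
  moreover have "char_poly ?E = [:- e, 1:]"
    by (simp add: char_poly_defs det_def sign_def)
  ultimately have "[:- e, 1:] * char_poly A3 = [:- e, 1:] * (\<Prod>e\<leftarrow>es. [:- e, 1:])"
    using cp by simp
  then have "char_poly A3 = (\<Prod>e\<leftarrow>es. [:- e, 1:])"
    by (simp only: mult_cancel_left) simp
  from Cons.IH[OF A3 symA3 this] obtain P where P: "P \<in> carrier_mat m m"
    "transpose_mat P * P = 1\<^sub>m m" "transpose_mat P * A3 * P = mat_diag m (\<lambda>i. es ! i)" by auto
  define P' where "P' = four_block_mat (1\<^sub>m 1) (0\<^sub>m 1 m) (0\<^sub>m m 1) P"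
  have P': "P' \<in> carrier_mat n n" unfolding P'_def n(1) by (intro four_block_carrier_mat) (use P in auto)
  have tP': "transpose_mat P' = four_block_mat (1\<^sub>m 1) (0\<^sub>m 1 m) (0\<^sub>m m 1) (transpose_mat P)"
    unfolding P'_def using P by (subst transpose_four_block_mat) auto
  have P'P': "transpose_mat P' * P' = 1\<^sub>m n"
    unfolding tP' unfolding P'_def using P
    by (subst mult_four_block_mat[of _ 1 1 _ m _ m _ _ 1 _ m])
      (auto simp: n intro!: eq_matI)
  have "transpose_mat P' * A' * P' = four_block_mat ?E (0\<^sub>m 1 m) (0\<^sub>m m 1) (transpose_mat P * A3 * P)"
    unfolding tP' A'_block unfolding P'_def using P A3
    by (subst mult_four_block_mat[of _ 1 1 _ m _ m _ _ 1 _ m], auto)+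
  also have "\<dots> = mat_diag n (\<lambda>i. (e # es) ! i)"
    unfolding P(3) n by (intro eq_matI) (auto simp: four_block_mat_def mat_diag_def nth_Cons')
  finally have diag: "transpose_mat P' * A' * P' = mat_diag n (\<lambda>i. (e # es) ! i)" .
  have tWP: "transpose_mat (W * P') = transpose_mat P' * W"
    using W P' by (simp add: transpose_mult[of _ n n _ n])
  show ?case
  proof (intro bexI[of _ "W * P'"] conjI)
    show "W * P' \<in> carrier_mat n n" using W P' by simp
    have "transpose_mat (W * P') * (W * P') = transpose_mat P' * (W * W) * P'"
      unfolding tWP using W(1) P' by (simp add: assoc_mult_mat[of _ n n _ n _ n])
    then show "transpose_mat (W * P') * (W * P') = 1\<^sub>m n" using W(3) P'P' P' by simp
    have "transpose_mat (W * P') * A * (W * P') = transpose_mat P' * A' * P'"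
      unfolding tWP A'_def using W(1) P' A by (simp add: assoc_mult_mat[of _ n n _ n _ n])
    then show "transpose_mat (W * P') * A * (W * P') = mat_diag n (\<lambda>i. (e # es) ! i)"
      using diag by simp
  qed
qed

text \<open>This links the definition through sorted characteristic roots to an orthonormal
  eigenbasis. Columns count from 0 and eigenvalues from 1, hence the shift in the index.\<close>

lemma kth_eigenvalue_eigenbasis:
  assumes A: "A \<in> carrier_mat n n" and sym: "transpose_mat A = A"
  shows "\<exists>P. orthonormal_columns n n P \<and>
      (\<forall>k<n. A *\<^sub>v col P k = kth_eigenvalue (k + 1) A \<cdot>\<^sub>v col P k)"
    and "\<lbrakk>1 \<le> j; j \<le> k; k \<le> n\<rbrakk> \<Longrightarrow> kth_eigenvalue k A \<le> kth_eigenvalue j A"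
proof -
  obtain es0 where es0: "char_poly A = (\<Prod>e\<leftarrow>es0. [:- e, 1:])" "length es0 = n"
    using char_poly_splits_if_symmetric[OF A sym] by auto
  define es where "es = rev (sorted_list_of_multiset (proots (char_poly A)))"
  have "proots (\<Prod>e\<leftarrow>xs. [:- e, 1:]) = mset xs" for xs :: "real list"
  proof (induction xs)
    case (Cons e xs)
    have "(\<Prod>e\<leftarrow>xs. [:- e, 1:]) \<noteq> 0" by (auto simp: prod_list_zero_iff)
    then show ?case using Cons by (simp add: proots_mult del: mult_pCons_left)
  qed simp
  then have "proots (char_poly A) = mset es0" unfolding es0(1) .
  then have es: "mset es = mset es0" unfolding es_def by simp
  then have len: "length es = n" using es0(2) by (metis size_mset)
  \<comment> \<open>A product of linear factors depends only on the multiset of roots, so the sorted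
    list may replace \<open>es0\<close>.\<close>
  have cp: "char_poly A = (\<Prod>e\<leftarrow>es. [:- e, 1:])"
    unfolding es0(1) using es by (metis mset_map prod_mset_prod_list)
  have kth: "kth_eigenvalue k A = es ! (k - 1)" for k
    unfolding kth_eigenvalue_def es_def ..
  obtain P where P: "P \<in> carrier_mat n n" "transpose_mat P * P = 1\<^sub>m n"
    "transpose_mat P * A * P = mat_diag n (\<lambda>i. es ! i)"
    using symmetric_orthogonally_diagonalizable[OF A sym cp] by auto
  have PP: "P * transpose_mat P = 1\<^sub>m n"
    using mat_mult_left_right_inverse[of "transpose_mat P" n P] P by auto
  have "A * P = P * (transpose_mat P * A * P)"
  proof -
    have "P * (transpose_mat P * A * P) = (P * transpose_mat P) * (A * P)"
      using P(1) A by (simp add: assoc_mult_mat[of _ n n _ n _ n])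
    then show ?thesis unfolding PP using A P(1) by simp
  qed
  then have AP: "A * P = P * mat_diag n (\<lambda>i. es ! i)" using P(3) by simp
  have "A *\<^sub>v col P k = kth_eigenvalue (k + 1) A \<cdot>\<^sub>v col P k" if "k < n" for k
  proof -
    have "A *\<^sub>v col P k = col (A * P) k" using A P(1) that by (intro col_mult2[symmetric]) auto
    also have "\<dots> = (es ! k) \<cdot>\<^sub>v col P k"
      unfolding AP using P(1) that
      by (subst mat_diag_mult_right[of _ n n]) (auto intro!: eq_vecI simp: mult.commute)
    finally show ?thesis unfolding kth by simp
  qed
  then show "\<exists>P. orthonormal_columns n n P \<and>
      (\<forall>k<n. A *\<^sub>v col P k = kth_eigenvalue (k + 1) A \<cdot>\<^sub>v col P k)"
    using P unfolding orthonormal_columns_def by auto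
  have "sorted (rev es)" unfolding es_def by simp
  then show "kth_eigenvalue k A \<le> kth_eigenvalue j A" if "1 \<le> j" "j \<le> k" "k \<le> n"
    unfolding kth using that len by (intro sorted_rev_nth_mono) auto
qed


section \<open>Quadratic forms and Weyl's inequality\<close>

lemma scalar_prod_symmetric_mat:
  fixes A :: "real mat"
  assumes "A \<in> carrier_mat n n" "transpose_mat A = A" "x \<in> carrier_vec n" "y \<in> carrier_vec n"
  shows "x \<bullet> (A *\<^sub>v y) = y \<bullet> (A *\<^sub>v x)"
proof -
  have "x \<bullet> (A *\<^sub>v y) = (A *\<^sub>v x) \<bullet> y"
    using transpose_vec_mult_scalar[of A n n y x] assms by simp
  then show ?thesis using assms by (simp add: comm_scalar_prod[of y n])
qed

lemma orthonormal_columns_scalar_prod: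
  assumes "orthonormal_columns n r P" "i < r" "j < r"
  shows "col P i \<bullet> col P j = (if i = j then 1 else 0)"
proof -
  have carrier: "P \<in> carrier_mat n r" using assms(1) unfolding orthonormal_columns_def by simp
  have "(transpose_mat P * P) $$ (i, j) = col P i \<bullet> col P j"
    using assms(2,3) carrier unfolding orthonormal_columns_def by simp
  moreover have "transpose_mat P * P = 1\<^sub>m r" using assms(1) unfolding orthonormal_columns_def by simp
  ultimately show ?thesis using assms(2,3) by simp
qed

text \<open>Parseval's identity. As \<open>P\<close> is square, its left inverse
  \<open>transpose_mat P\<close> is also a right inverse.\<close>

lemma orthonormal_basis_expansion:
  assumes P: "orthonormal_columns n n P" and x: "x \<in> carrier_vec n" and y: "y \<in> carrier_vec n"
  shows "x \<bullet> y = (\<Sum>k<n. (col P k \<bullet> x) * (col P k \<bullet> y))"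
proof -
  have P': "P \<in> carrier_mat n n" "transpose_mat P * P = 1\<^sub>m n"
    using P unfolding orthonormal_columns_def by auto
  have "P * transpose_mat P = 1\<^sub>m n"
    using mat_mult_left_right_inverse[of "transpose_mat P" n P] P' by auto
  moreover have "P *\<^sub>v (transpose_mat P *\<^sub>v y) = (P * transpose_mat P) *\<^sub>v y"
    using P' y by simp
  ultimately have "y = P *\<^sub>v (transpose_mat P *\<^sub>v y)" using y by simp
  then have "x \<bullet> y = x \<bullet> (P *\<^sub>v (transpose_mat P *\<^sub>v y))" by (rule arg_cong)
  also have "\<dots> = (transpose_mat P *\<^sub>v x) \<bullet> (transpose_mat P *\<^sub>v y)"
    using transpose_vec_mult_scalar[of P n n "transpose_mat P *\<^sub>v y" x] P' x y by auto
  also have "\<dots> = (\<Sum>k<n. (col P k \<bullet> x) * (col P k \<bullet> y))"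
    using P' by (auto simp: scalar_prod_def[of "transpose_mat P *\<^sub>v x"] atLeast0LessThan intro!: sum.cong)
  finally show ?thesis .
qed

lemma eigenbasis_quadratic_form:
  fixes A :: "real mat"
  assumes A: "A \<in> carrier_mat n n" and sym: "transpose_mat A = A"
    and P: "orthonormal_columns n n P" and ev: "\<And>k. k < n \<Longrightarrow> A *\<^sub>v col P k = e k \<cdot>\<^sub>v col P k"
    and x: "x \<in> carrier_vec n"
  shows "x \<bullet> (A *\<^sub>v x) = (\<Sum>k<n. e k * (col P k \<bullet> x)\<^sup>2)"
proof -
  have "col P k \<bullet> (A *\<^sub>v x) = e k * (col P k \<bullet> x)" if "k < n" for k
  proof -
    have c: "col P k \<in> carrier_vec n" using P unfolding orthonormal_columns_def by auto
    show ?thesis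
      using scalar_prod_symmetric_mat[OF A sym c x] ev[OF that] c x
      by (simp add: comm_scalar_prod[of x n])
  qed
  then show ?thesis
    using orthonormal_basis_expansion[OF P x, of "A *\<^sub>v x"] A x
    by (auto simp: power2_eq_square intro!: sum.cong)
qed

text \<open>A dimension count as in the Courant-Fischer theorem: the span of \<open>r\<close>
  leading eigenvectors of \<open>B\<close> meets the orthogonal complement of \<open>r - 1\<close>
  leading eigenvectors of \<open>A\<close> in some nonzero \<open>x\<close>. There the form of
  \<open>B\<close> is at least, and that of \<open>A\<close> at most, the respective
  \<open>r\<close>-th eigenvalue times \<open>x \<bullet> x\<close>.\<close>

lemma weyl_lower_bound:
  fixes A B :: "real mat"
  assumes A: "A \<in> carrier_mat n n" "transpose_mat A = A"
    and B: "B \<in> carrier_mat n n" "transpose_mat B = B"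
    and close: "\<And>x. x \<in> carrier_vec n \<Longrightarrow> x \<bullet> (B *\<^sub>v x) - \<epsilon> * (x \<bullet> x) \<le> x \<bullet> (A *\<^sub>v x)"
    and r: "1 \<le> r" "r \<le> n"
  shows "kth_eigenvalue r B - \<epsilon> \<le> kth_eigenvalue r A"
proof -
  obtain P where P: "orthonormal_columns n n P"
    "\<And>k. k < n \<Longrightarrow> A *\<^sub>v col P k = kth_eigenvalue (k + 1) A \<cdot>\<^sub>v col P k"
    using kth_eigenvalue_eigenbasis(1)[OF A] by auto
  obtain Q where Q: "orthonormal_columns n n Q"
    "\<And>k. k < n \<Longrightarrow> B *\<^sub>v col Q k = kth_eigenvalue (k + 1) B \<cdot>\<^sub>v col Q k"
    using kth_eigenvalue_eigenbasis(1)[OF B] by auto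
  have Pc: "col P k \<in> carrier_vec n" and Qc: "col Q k \<in> carrier_vec n" for k
    using P(1) Q(1) unfolding orthonormal_columns_def by auto
  \<comment> \<open>the kernel of \<open>N\<close>, whose last row is 0, yields \<open>x\<close> in the span of the first \<open>r\<close> columns of \<open>Q\<close>
    that is orthogonal to the first \<open>r - 1\<close> columns of \<open>P\<close>\<close>
  define N where "N = Matrix.mat r r (\<lambda>(i, j). if i + 1 = r then 0 else col P i \<bullet> col Q j)"
  have N: "N \<in> carrier_mat r r" unfolding N_def by simp
  have "N = mat\<^sub>r r r (\<lambda>i. if i = r - 1 then 0\<^sub>v r else Matrix.vec r (\<lambda>j. col P i \<bullet> col Q j))"
    unfolding N_def by (intro eq_matI) auto
  then have "det N = 0" using r det_row_0[of "r - 1" r "\<lambda>i. Matrix.vec r (\<lambda>j. col P i \<bullet> col Q j)"] by simp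
  then obtain a where a: "a \<in> carrier_vec r" "a \<noteq> 0\<^sub>v r" "N *\<^sub>v a = 0\<^sub>v r"
    using det_0_iff_vec_prod_zero[OF N] by auto
  \<comment> \<open>Padding with zeros makes \<open>a'\<close> the full coordinate vector of
    \<open>x\<close> in the basis \<open>Q\<close>.\<close>
  define a' where "a' = Matrix.vec n (\<lambda>k. if k < r then a $ k else 0)"
  define x where "x = Q *\<^sub>v a'"
  have Q': "Q \<in> carrier_mat n n" using Q(1) unfolding orthonormal_columns_def by simp
  have a': "a' \<in> carrier_vec n" unfolding a'_def by simp
  have x: "x \<in> carrier_vec n" unfolding x_def using Q' a' by simp
  have "transpose_mat Q *\<^sub>v x = (transpose_mat Q * Q) *\<^sub>v a'"
    unfolding x_def using Q' a' by simp
  then have "transpose_mat Q *\<^sub>v x = a'"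
    using Q(1) a' unfolding orthonormal_columns_def by simp
  moreover have "(transpose_mat Q *\<^sub>v x) $ k = col Q k \<bullet> x" if "k < n" for k
    using that Q' by simp
  ultimately have Qx: "col Q k \<bullet> x = (if k < r then a $ k else 0)" if "k < n" for k
    using that unfolding a'_def by simp
  have Px: "col P k \<bullet> x = 0" if k: "k + 1 < r" for k
  proof -
    have "(\<Sum>j<r. (col P k \<bullet> col Q j) * a $ j) = (N *\<^sub>v a) $ k"
      using k N a(1) by (auto simp: N_def scalar_prod_def atLeast0LessThan intro!: sum.cong)
    then have 0: "(\<Sum>j<r. (col P k \<bullet> col Q j) * a $ j) = 0" using a(3) k by simp
    \<comment> \<open>In the basis \<open>Q\<close> only the first \<open>r\<close> coordinates of
      \<open>x\<close> survive, and they are those of \<open>a\<close>; so row \<open>k\<close> of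
      \<open>N\<close> applied to \<open>a\<close> appears.\<close>
    have "col P k \<bullet> x = (\<Sum>j<n. (col Q j \<bullet> col P k) * (col Q j \<bullet> x))"
      by (rule orthonormal_basis_expansion[OF Q(1) Pc x])
    also have "\<dots> = (\<Sum>j<n. if j < r then (col P k \<bullet> col Q j) * a $ j else 0)"
      using Pc Qc by (intro sum.cong refl) (auto simp: Qx comm_scalar_prod[of "col P k" n])
    also have "\<dots> = (\<Sum>j<r. (col P k \<bullet> col Q j) * a $ j)"
      using r by (intro sum.mono_neutral_cong_right) auto
    finally show ?thesis using 0 by simp
  qed
  have xx: "x \<bullet> x = (\<Sum>k<n. (col P k \<bullet> x)\<^sup>2)" "x \<bullet> x = (\<Sum>k<n. (col Q k \<bullet> x)\<^sup>2)"
    using orthonormal_basis_expansion[OF P(1) x x] orthonormal_basis_expansion[OF Q(1) x x]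
    by (simp_all add: power2_eq_square)
  have "x \<bullet> x \<noteq> 0"
  proof
    assume "x \<bullet> x = 0"
    then have "\<forall>k<n. (col Q k \<bullet> x)\<^sup>2 = 0" unfolding xx(2) by (subst (asm) sum_nonneg_eq_0_iff) auto
    then have "a = 0\<^sub>v r" using r a(1) Qx by (intro eq_vecI) (auto split: if_splits)
    with a(2) show False by simp
  qed
  moreover have "x \<bullet> x \<ge> 0" unfolding xx(1) by (intro sum_nonneg) auto
  ultimately have pos: "x \<bullet> x > 0" by simp
  have "kth_eigenvalue r B * (x \<bullet> x) \<le> x \<bullet> (B *\<^sub>v x)"
    unfolding eigenbasis_quadratic_form[OF B Q x, simplified] unfolding xx(2) sum_distrib_left
  proof (intro sum_mono)
    fix k assume k: "k \<in> {..<n}"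
    show "kth_eigenvalue r B * (col Q k \<bullet> x)\<^sup>2 \<le> kth_eigenvalue (Suc k) B * (col Q k \<bullet> x)\<^sup>2"
    proof (cases "k < r")
      case True
      then show ?thesis using kth_eigenvalue_eigenbasis(2)[OF B, of "Suc k" r] r
        by (intro mult_right_mono) auto
    next
      case False
      then show ?thesis using Qx k by simp
    qed
  qed
  moreover have "x \<bullet> (A *\<^sub>v x) \<le> kth_eigenvalue r A * (x \<bullet> x)"
    unfolding eigenbasis_quadratic_form[OF A P x, simplified] unfolding xx(1) sum_distrib_left
  proof (intro sum_mono)
    fix k assume k: "k \<in> {..<n}"
    show "kth_eigenvalue (Suc k) A * (col P k \<bullet> x)\<^sup>2 \<le> kth_eigenvalue r A * (col P k \<bullet> x)\<^sup>2"
    proof (cases "k + 1 < r")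
      case True
      then show ?thesis using Px by simp
    next
      case False
      then show ?thesis using kth_eigenvalue_eigenbasis(2)[OF A, of r "Suc k"] r k
        by (intro mult_right_mono) auto
    qed
  qed
  ultimately have "(kth_eigenvalue r B - \<epsilon>) * (x \<bullet> x) \<le> kth_eigenvalue r A * (x \<bullet> x)"
    using close[OF x] by (simp add: algebra_simps)
  then show ?thesis using pos by simp
qed

section \<open>The operator norm\<close>

lemma scalar_prod_cauchy_schwarz:
  fixes x y :: "real vec"
  assumes "x \<in> carrier_vec n" "y \<in> carrier_vec n"
  shows "(x \<bullet> y)\<^sup>2 \<le> (x \<bullet> x) * (y \<bullet> y)"
  using assms Cauchy_Schwarz_ineq_sum[of "($) x" "($) y" "{..<n}"]
  by (simp add: scalar_prod_def atLeast0LessThan power2_eq_square)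

text \<open>A real supremum says something only if it is over a bounded set. The squared Frobenius
  norm \<open>F\<close> provides the bound, by Cauchy-Schwarz in every row; scaling to unit vectors
  gives the inequality for all \<open>x\<close>.\<close>

lemma op_norm_bound:
  fixes A :: "real mat"
  assumes A: "A \<in> carrier_mat m n" and x: "x \<in> carrier_vec n"
  shows "(A *\<^sub>v x) \<bullet> (A *\<^sub>v x) \<le> (op_norm A)\<^sup>2 * (x \<bullet> x)"
    and "0 \<le> op_norm A"
proof -
  define F where "F = (\<Sum>i<m. row A i \<bullet> row A i)"
  have nn: "0 \<le> y \<bullet> y" for y :: "real vec" by (simp add: scalar_prod_def sum_nonneg)
  have F: "(A *\<^sub>v y) \<bullet> (A *\<^sub>v y) \<le> F * (y \<bullet> y)" if "y \<in> carrier_vec n" for y :: "real vec"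
  proof -
    have "(A *\<^sub>v y) \<bullet> (A *\<^sub>v y) = (\<Sum>i<m. (row A i \<bullet> y)\<^sup>2)"
      using A by (auto simp: scalar_prod_def[of "A *\<^sub>v y"] atLeast0LessThan power2_eq_square intro!: sum.cong)
    also have "\<dots> \<le> F * (y \<bullet> y)"
      unfolding F_def sum_distrib_right
      using A that by (intro sum_mono scalar_prod_cauchy_schwarz[of _ n]) auto
    finally show ?thesis .
  qed
  let ?S = "{x :: real vec. x \<in> carrier_vec (dim_col A) \<and> x \<bullet> x \<le> 1}"
  have bdd: "bdd_above ((\<lambda>x. sqrt ((A *\<^sub>v x) \<bullet> (A *\<^sub>v x))) ` ?S)"
  proof (intro bdd_aboveI2[of _ _ "sqrt F"])
    fix y assume y: "y \<in> ?S"
    have "F \<ge> 0" unfolding F_def by (intro sum_nonneg nn)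
    then have "F * (y \<bullet> y) \<le> F" using y mult_left_mono[of "y \<bullet> y" 1 F] by simp
    then show "sqrt ((A *\<^sub>v y) \<bullet> (A *\<^sub>v y)) \<le> sqrt F" using F[of y] y A by simp
  qed
  have up: "sqrt ((A *\<^sub>v y) \<bullet> (A *\<^sub>v y)) \<le> op_norm A" if "y \<in> carrier_vec n" "y \<bullet> y \<le> 1" for y :: "real vec"
    unfolding op_norm_def using that A by (intro cSUP_upper bdd) auto
  have "sqrt ((A *\<^sub>v 0\<^sub>v n) \<bullet> (A *\<^sub>v 0\<^sub>v n)) \<le> op_norm A" by (intro up) auto
  then show nonneg: "0 \<le> op_norm A" using real_sqrt_ge_zero[OF nn] order_trans by blast
  show "(A *\<^sub>v x) \<bullet> (A *\<^sub>v x) \<le> (op_norm A)\<^sup>2 * (x \<bullet> x)"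
  proof (cases "x = 0\<^sub>v n")
    case True
    then show ?thesis using F[OF x] by simp
  next
    case False
    then have pos: "x \<bullet> x > 0" using conjugate_square_greater_0_vec[OF x] by simp
    define y where "y = (1 / sqrt (x \<bullet> x)) \<cdot>\<^sub>v x"
    have y: "y \<in> carrier_vec n" "y \<bullet> y = 1" unfolding y_def using x pos by auto
    have "(A *\<^sub>v y) \<bullet> (A *\<^sub>v y) = (A *\<^sub>v x) \<bullet> (A *\<^sub>v x) / (x \<bullet> x)"
      unfolding y_def using A x pos by (simp add: mult_mat_vec[OF A x])
    moreover have "(A *\<^sub>v y) \<bullet> (A *\<^sub>v y) \<le> (op_norm A)\<^sup>2"
      using up[OF y(1)] y(2) sqrt_le_D by simp
    ultimately have "(A *\<^sub>v x) \<bullet> (A *\<^sub>v x) / (x \<bullet> x) \<le> (op_norm A)\<^sup>2" by simp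
    then show ?thesis using pos by (simp only: pos_divide_le_eq)
  qed
qed

lemma op_norm_bilinear_bound:
  fixes A :: "real mat"
  assumes A: "A \<in> carrier_mat m n" and x: "x \<in> carrier_vec n" and y: "y \<in> carrier_vec m"
  shows "(y \<bullet> (A *\<^sub>v x))\<^sup>2 \<le> (op_norm A)\<^sup>2 * ((x \<bullet> x) * (y \<bullet> y))"
proof -
  have "(y \<bullet> (A *\<^sub>v x))\<^sup>2 \<le> (y \<bullet> y) * ((A *\<^sub>v x) \<bullet> (A *\<^sub>v x))"
    using A x y by (intro scalar_prod_cauchy_schwarz[of _ m]) auto
  also have "\<dots> \<le> (y \<bullet> y) * ((op_norm A)\<^sup>2 * (x \<bullet> x))"
    by (intro mult_left_mono op_norm_bound[OF A x]) (simp add: scalar_prod_def sum_nonneg)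
  finally show ?thesis by (simp add: ac_simps)
qed


section \<open>Angles between column spaces\<close>

text \<open>Here \<open>w\<close> is what remains of \<open>v\<close> after orthogonal projection
  onto the column space of \<open>U\<close>. For a unit vector \<open>v\<close>, the number
  \<open>w \<bullet> w\<close> is the squared sine of its angle with that space.\<close>

lemma orthogonal_residual:
  fixes v :: "real vec"
  assumes U: "orthonormal_columns n r U" and v: "v \<in> carrier_vec n"
  defines "w \<equiv> v - U *\<^sub>v (transpose_mat U *\<^sub>v v)"
  shows "w \<in> carrier_vec n"
    and "k < r \<Longrightarrow> col U k \<bullet> w = 0"
    and "x \<in> carrier_vec n \<Longrightarrow> w \<bullet> x = v \<bullet> x - (\<Sum>k<r. (col U k \<bullet> v) * (col U k \<bullet> x))"
    and "w \<bullet> w = v \<bullet> v - (\<Sum>k<r. (col U k \<bullet> v)\<^sup>2)"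
    and "w \<bullet> v = w \<bullet> w"
proof -
  have U': "U \<in> carrier_mat n r" "transpose_mat U * U = 1\<^sub>m r"
    using U unfolding orthonormal_columns_def by auto
  let ?c = "transpose_mat U *\<^sub>v v"
  have c: "?c \<in> carrier_vec r" using U'(1) v by (intro mult_mat_vec_carrier) auto
  have Uc: "U *\<^sub>v ?c \<in> carrier_vec n" using U'(1) c by (rule mult_mat_vec_carrier)
  show w: "w \<in> carrier_vec n" unfolding w_def using U' v by auto
  show inner: "w \<bullet> x = v \<bullet> x - (\<Sum>k<r. (col U k \<bullet> v) * (col U k \<bullet> x))" if x: "x \<in> carrier_vec n" for x
  proof -
    have "(U *\<^sub>v ?c) \<bullet> x = x \<bullet> (U *\<^sub>v ?c)" using Uc x by (rule comm_scalar_prod)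
    also have "\<dots> = (transpose_mat U *\<^sub>v x) \<bullet> ?c"
      using transpose_vec_mult_scalar[OF U'(1) c x] by simp
    also have "\<dots> = (\<Sum>k<r. (col U k \<bullet> v) * (col U k \<bullet> x))"
      using U' by (auto simp: scalar_prod_def[of "transpose_mat U *\<^sub>v x"] atLeast0LessThan intro!: sum.cong)
    finally show ?thesis
      unfolding w_def using minus_scalar_prod_distrib[OF v Uc x] by simp
  qed
  have colU: "col U k \<in> carrier_vec n" for k using U' by auto
  show orth: "col U k \<bullet> w = 0" if k: "k < r" for k
  proof -
    have "col U k \<bullet> w = w \<bullet> col U k" using colU w by (rule comm_scalar_prod)
    also have "\<dots> = v \<bullet> col U k - (\<Sum>j<r. if j = k then col U j \<bullet> v else 0)"
      unfolding inner[OF colU] using k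
      by (intro arg_cong2[of _ _ _ _ minus] sum.cong refl) (auto simp: orthonormal_columns_scalar_prod[OF U])
    also have "\<dots> = 0" using k comm_scalar_prod[OF v colU] by simp
    finally show ?thesis .
  qed
  have "w \<bullet> w = v \<bullet> w" unfolding inner[OF w] using orth by simp
  then show wv: "w \<bullet> v = w \<bullet> w" using comm_scalar_prod[OF v w] by simp
  then show "w \<bullet> w = v \<bullet> v - (\<Sum>k<r. (col U k \<bullet> v)\<^sup>2)"
    unfolding inner[OF v] by (simp add: power2_eq_square)
qed

text \<open>The sum of the squared sines of the principal angles between the two column spaces.\<close>

definition subspace_gap :: "nat \<Rightarrow> real mat \<Rightarrow> real mat \<Rightarrow> real" where
  "subspace_gap r U V = (\<Sum>k<r. 1 - (\<Sum>l<r. (col V l \<bullet> col U k)\<^sup>2))"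

text \<open>Either side is \<open>r\<close> minus the sum of all squared products of a column of
  \<open>U\<close> with a column of \<open>V\<close>. The symmetry is used because the perturbation
  bound controls the columns of \<open>V\<close>, while the projection error involves the residuals
  of the columns of \<open>U\<close>.\<close>

lemma subspace_gap_commute:
  assumes "orthonormal_columns n r U" "orthonormal_columns n r V"
  shows "subspace_gap r U V = subspace_gap r V U"
proof -
  have "col U k \<in> carrier_vec n" "col V l \<in> carrier_vec n" for k l
    using assms unfolding orthonormal_columns_def by auto
  then have "col V l \<bullet> col U k = col U k \<bullet> col V l" for k l by (simp add: comm_scalar_prod[of _ n])
  then show ?thesis
    unfolding subspace_gap_def sum_subtractf by (subst sum.swap) simp
qed

lemma subspace_gap_le: "subspace_gap r U V \<le> real r"
proof -
  have "subspace_gap r U V \<le> (\<Sum>k<r. 1)"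
    unfolding subspace_gap_def by (intro sum_mono) (simp add: sum_nonneg)
  then show ?thesis by simp
qed

text \<open>The inner sum is the best guess of a coordinate of the projection to \<open>U\<close>
  from the projection to \<open>V\<close> alone. Its error is the scalar product of \<open>x\<close>
  with the residual of a column of \<open>U\<close>, so Cauchy-Schwarz applies to each
  \<open>k\<close>.\<close>

lemma subspace_gap_bound:
  fixes x :: "real vec"
  assumes U: "orthonormal_columns n r U" and V: "orthonormal_columns n r V" and x: "x \<in> carrier_vec n"
  shows "(\<Sum>k<r. (col U k \<bullet> x - (\<Sum>l<r. (col V l \<bullet> col U k) * (col V l \<bullet> x)))\<^sup>2)
      \<le> (x \<bullet> x) * subspace_gap r U V"
  unfolding subspace_gap_def sum_distrib_left
proof (intro sum_mono)
  fix k assume k: "k \<in> {..<r}"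
  have u: "col U k \<in> carrier_vec n" using U unfolding orthonormal_columns_def by auto
  let ?w = "col U k - V *\<^sub>v (transpose_mat V *\<^sub>v col U k)"
  note w = orthogonal_residual[OF V u]
  have "(?w \<bullet> x)\<^sup>2 \<le> (?w \<bullet> ?w) * (x \<bullet> x)" by (rule scalar_prod_cauchy_schwarz[OF w(1) x])
  then show "(col U k \<bullet> x - (\<Sum>l<r. (col V l \<bullet> col U k) * (col V l \<bullet> x)))\<^sup>2
      \<le> (x \<bullet> x) * (1 - (\<Sum>l<r. (col V l \<bullet> col U k)\<^sup>2))"
    unfolding w(3)[OF x] w(4) using orthonormal_columns_scalar_prod[OF U, of k k] k
    by (simp add: mult.commute)
qed

text \<open>A bound of Davis-Kahan type. The residual \<open>w\<close> of a column of
  \<open>V\<close> is orthogonal to \<open>U\<close>, so \<open>B\<close> annihilates it, and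
  \<open>A - B\<close> alone accounts for the eigenvalue of \<open>A\<close> when its form is tested
  against \<open>w\<close>. Hypothesis \<open>ker\<close> thus takes the place of separation between
  two parts of the spectrum.\<close>

lemma subspace_gap_davis_kahan:
  assumes A: "A \<in> carrier_mat n n" "transpose_mat A = A"
    and B: "B \<in> carrier_mat n n" "transpose_mat B = B"
    and U: "orthonormal_columns n r U"
    and ker: "\<And>w. \<lbrakk>w \<in> carrier_vec n; \<forall>k<r. col U k \<bullet> w = 0\<rbrakk> \<Longrightarrow> B *\<^sub>v w = 0\<^sub>v n"
    and V: "top_eigenvectors n r A V"
    and gap: "g \<le> kth_eigenvalue r B" "op_norm (A - B) \<le> \<epsilon>" "\<epsilon> < g"
    and r: "1 \<le> r" "r \<le> n"
  shows "subspace_gap r U V \<le> real r * (\<epsilon> / (g - \<epsilon>))\<^sup>2"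
proof -
  let ?D = "A - B"
  have D: "?D \<in> carrier_mat n n" using A B by auto
  have Vo: "orthonormal_columns n r V"
    and Vev: "\<And>k. k < r \<Longrightarrow> eigenvector A (col V k) (kth_eigenvalue (k + 1) A)"
    using V unfolding top_eigenvectors_def by auto
  have opD: "0 \<le> op_norm ?D" using op_norm_bound(2)[OF D zero_carrier_vec] .
  have Dv: "?D *\<^sub>v x = A *\<^sub>v x - B *\<^sub>v x" if "x \<in> carrier_vec n" for x
    using A B that by (intro minus_mult_distrib_mat_vec)
  have nonneg: "0 \<le> x \<bullet> x" for x :: "real vec" by (simp add: scalar_prod_def sum_nonneg)
  have "kth_eigenvalue r B - op_norm ?D \<le> kth_eigenvalue r A"
  proof (rule weyl_lower_bound[OF A B _ r])
    fix x :: "real vec" assume x: "x \<in> carrier_vec n"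
    have "(x \<bullet> (?D *\<^sub>v x))\<^sup>2 \<le> (op_norm ?D * (x \<bullet> x))\<^sup>2"
      using op_norm_bilinear_bound[OF D x x] by (simp add: power2_eq_square ac_simps)
    then have "\<bar>x \<bullet> (?D *\<^sub>v x)\<bar> \<le> op_norm ?D * (x \<bullet> x)"
      using opD nonneg by (simp add: abs_le_square_iff[symmetric] abs_mult)
    moreover have "x \<bullet> (?D *\<^sub>v x) = x \<bullet> (A *\<^sub>v x) - x \<bullet> (B *\<^sub>v x)"
      unfolding Dv[OF x] using A B x by (intro scalar_prod_minus_distrib) auto
    ultimately show "x \<bullet> (B *\<^sub>v x) - op_norm ?D * (x \<bullet> x) \<le> x \<bullet> (A *\<^sub>v x)" by simp
  qed
  then have lam: "g - \<epsilon> \<le> kth_eigenvalue r A" using gap by simp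
  have each: "1 - (\<Sum>k<r. (col U k \<bullet> col V l)\<^sup>2) \<le> (\<epsilon> / (g - \<epsilon>))\<^sup>2" if l: "l < r" for l
  proof -
    have v: "col V l \<in> carrier_vec n" using Vo unfolding orthonormal_columns_def by auto
    define w where "w = col V l - U *\<^sub>v (transpose_mat U *\<^sub>v col V l)"
    note w = orthogonal_residual[OF U v, folded w_def]
    let ?e = "kth_eigenvalue (l + 1) A"
    have vv: "col V l \<bullet> col V l = 1" using orthonormal_columns_scalar_prod[OF Vo l l] by simp
    have lam_l: "g - \<epsilon> \<le> ?e" using kth_eigenvalue_eigenbasis(2)[OF A, of "l + 1" r] l r lam by auto
    have "B *\<^sub>v w = 0\<^sub>v n" using ker w(1,2) by blast
    then have "w \<bullet> (B *\<^sub>v col V l) = 0"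
      using scalar_prod_symmetric_mat[OF B w(1) v] v by simp
    moreover have "w \<bullet> (A *\<^sub>v col V l) = ?e * (w \<bullet> w)"
      using Vev[OF l] w(1,5) v unfolding eigenvector_def by simp
    ultimately have "w \<bullet> (?D *\<^sub>v col V l) = ?e * (w \<bullet> w)"
      unfolding Dv[OF v] using A B v w(1) by (subst scalar_prod_minus_distrib) auto
    then have "(?e * (w \<bullet> w))\<^sup>2 \<le> (op_norm ?D)\<^sup>2 * (w \<bullet> w)"
      using op_norm_bilinear_bound[OF D v w(1)] vv by simp
    also have "\<dots> \<le> \<epsilon>\<^sup>2 * (w \<bullet> w)" using gap(2) opD nonneg by (intro mult_right_mono power_mono)
    finally have 1: "?e\<^sup>2 * (w \<bullet> w) * (w \<bullet> w) \<le> \<epsilon>\<^sup>2 * (w \<bullet> w)" by (simp add: power2_eq_square ac_simps)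
    \<comment> \<open>One factor \<open>w \<bullet> w\<close> is cancelled from the previous
      inequality; a vanishing residual satisfies the claim trivially.\<close>
    have "?e\<^sup>2 * (w \<bullet> w) \<le> \<epsilon>\<^sup>2"
    proof (cases "w \<bullet> w = 0")
      case False
      then have "w \<bullet> w > 0" using nonneg[of w] by simp
      then show ?thesis using 1 by simp
    qed simp
    moreover have "(g - \<epsilon>)\<^sup>2 * (w \<bullet> w) \<le> ?e\<^sup>2 * (w \<bullet> w)"
      using lam_l gap(3) nonneg by (intro mult_right_mono power_mono) auto
    ultimately have "(w \<bullet> w) * (g - \<epsilon>)\<^sup>2 \<le> \<epsilon>\<^sup>2" by (simp add: mult.commute)
    then have "w \<bullet> w \<le> (\<epsilon> / (g - \<epsilon>))\<^sup>2"
      using gap(3) by (simp add: power_divide pos_le_divide_eq)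
    then show ?thesis using w(4) vv by simp
  qed
  have "subspace_gap r V U \<le> (\<Sum>l<r. (\<epsilon> / (g - \<epsilon>))\<^sup>2)"
    unfolding subspace_gap_def using each by (intro sum_mono) auto
  then show ?thesis using subspace_gap_commute[OF U Vo] by simp
qed

lemma subspace_gap_nonneg:
  assumes U: "orthonormal_columns n r U" and V: "orthonormal_columns n r V"
  shows "0 \<le> subspace_gap r U V"
  unfolding subspace_gap_def
proof (intro sum_nonneg)
  fix k assume k: "k \<in> {..<r}"
  have u: "col U k \<in> carrier_vec n" using U unfolding orthonormal_columns_def by auto
  have "0 \<le> x \<bullet> x" for x :: "real vec" by (simp add: scalar_prod_def sum_nonneg)
  then show "0 \<le> 1 - (\<Sum>l<r. (col V l \<bullet> col U k)\<^sup>2)"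
    using orthogonal_residual(4)[OF V u] orthonormal_columns_scalar_prod[OF U, of k k] k by (metis lessThan_iff)
qed

section \<open>Euclidean spaces as product measurable spaces\<close>

lemma space_Rsp: "space (Rsp p) = PiE {..<p} (\<lambda>_. UNIV)"
  by (simp add: space_PiM)

lemma l2dist_commute: "l2dist p x y = l2dist p y x"
  unfolding l2dist_def L2_set_def by (simp add: power2_commute)

lemma l2dist_triangle: "l2dist p x z \<le> l2dist p x y + l2dist p y z"
  unfolding l2dist_def using L2_set_triangle_ineq[of "\<lambda>i. x i - y i" "\<lambda>i. y i - z i" "{..<p}"] by simp

lemma borel_measurable_l2dist [measurable (raw)]:
  assumes "F \<in> measurable N (Rsp p)" "G \<in> measurable N (Rsp p)"
  shows "(\<lambda>x. l2dist p (F x) (G x)) \<in> borel_measurable N"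
proof -
  have [measurable]: "(\<lambda>x. F x i) \<in> borel_measurable N" "(\<lambda>x. G x i) \<in> borel_measurable N" if "i < p" for i
    using measurable_compose[OF assms(1) measurable_component_singleton]
      measurable_compose[OF assms(2) measurable_component_singleton] that by auto
  show ?thesis unfolding l2dist_def L2_set_def by measurable
qed

section \<open>Separability, Lipschitz extension and the support of a law\<close>

text \<open>A countable dense set, by which uncountable infima and uncountable families of balls are
  reduced to countable ones.\<close>

definition rational_points :: "nat \<Rightarrow> (nat \<Rightarrow> real) set" where
  "rational_points p = PiE {..<p} (\<lambda>_. \<rat>)"

lemma countable_rational_points: "countable (rational_points p)"
  unfolding rational_points_def by (intro countable_PiE) (auto simp: countable_rat)

lemma rational_points_subset: "rational_points p \<subseteq> space (Rsp p)"
  unfolding rational_points_def space_Rsp by (intro PiE_mono) auto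

lemma rational_points_dense:
  assumes \<eta>: "\<eta> > 0"
  shows "\<exists>q\<in>rational_points p. l2dist p x q < \<eta>"
proof -
  \<comment> \<open>The \<open>p\<close> coordinate errors, each at most \<theta>, then add up to
    less than \<eta>. The summand 1 avoids division by 0 when \<open>p\<close> is 0.\<close>
  define \<theta> where "\<theta> = \<eta> / (real p + 1)"
  have \<theta>: "\<theta> > 0" unfolding \<theta>_def using \<eta> by simp
  have "\<exists>a\<in>\<rat>. x i - \<theta> < a \<and> a < x i" for i
    using Rats_dense_in_real[of "x i - \<theta>" "x i"] \<theta> by auto
  then obtain a where a: "\<And>i. a i \<in> \<rat>" "\<And>i. x i - \<theta> < a i \<and> a i < x i" by metis
  define q where "q = restrict a {..<p}"
  have "q \<in> rational_points p" unfolding q_def rational_points_def using a by auto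
  moreover have "l2dist p x q \<le> (\<Sum>i<p. \<bar>x i - q i\<bar>)"
    unfolding l2dist_def by (rule L2_set_le_sum_abs)
  moreover have "(\<Sum>i<p. \<bar>x i - q i\<bar>) \<le> (\<Sum>i<p. \<theta>)"
  proof (intro sum_mono)
    fix i assume "i \<in> {..<p}"
    then show "\<bar>x i - q i\<bar> \<le> \<theta>" using a(2)[of i] by (simp add: q_def abs_le_iff)
  qed
  moreover have "(\<Sum>i<p. \<theta>) < \<eta>"
    unfolding \<theta>_def using \<eta> by (simp add: field_simps)
  ultimately show ?thesis by (intro bexI[of _ q]) auto
qed

text \<open>The set \<open>A\<close> may miss all rational points. For every rational centre and
  every radius \<open>1 / real (Suc n)\<close>, one point of \<open>A\<close> in that ball is
  selected if there is any.\<close>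

lemma countable_dense_subset:
  "\<exists>D\<subseteq>A. countable D \<and> (\<forall>x\<in>A. \<forall>\<eta>>0. \<exists>q\<in>D. l2dist p x q < \<eta>)"
proof -
  define I where "I = {(q, n::nat). q \<in> rational_points p \<and> (\<exists>a\<in>A. l2dist p a q < 1 / real (Suc n))}"
  define c where "c = (\<lambda>(q, n). SOME a. a \<in> A \<and> l2dist p a q < 1 / real (Suc n))"
  have c: "c (q, n) \<in> A \<and> l2dist p (c (q, n)) q < 1 / real (Suc n)" if "(q, n) \<in> I" for q n
  proof -
    have "\<exists>a. a \<in> A \<and> l2dist p a q < 1 / real (Suc n)" using that unfolding I_def by auto
    then show ?thesis unfolding c_def prod.case by (rule someI_ex)
  qed
  have "I \<subseteq> rational_points p \<times> UNIV" unfolding I_def by auto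
  then have "countable I"
    by (rule countable_subset) (intro countable_SIGMA countable_rational_points, simp)
  moreover have "\<exists>q\<in>c ` I. l2dist p x q < \<eta>" if x: "x \<in> A" and \<eta>: "\<eta> > 0" for x \<eta>
  proof -
    obtain n where n: "1 / real (Suc n) < \<eta> / 2" using nat_approx_posE[of "\<eta> / 2"] \<eta> by auto
    obtain q where q: "q \<in> rational_points p" "l2dist p x q < 1 / real (Suc n)"
      using rational_points_dense[of "1 / real (Suc n)" p x] by auto
    then have I: "(q, n) \<in> I" unfolding I_def using x by auto
    have "l2dist p x (c (q, n)) \<le> l2dist p x q + l2dist p (c (q, n)) q"
      using l2dist_triangle[of p x "c (q, n)" q] l2dist_commute[of p q] by simp
    also have "\<dots> < \<eta>" using c[OF I] q(2) n by simp
    finally show ?thesis using I by blast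
  qed
  moreover have "c ` I \<subseteq> A" using c by auto
  ultimately show ?thesis by blast
qed

text \<open>McShane's formula, with the infimum over a countable dense subset \<open>D\<close> of
  \<open>A\<close> so that \<open>h\<close> is measurable although nothing of this kind is known of
  \<open>g\<close>. Taking \<open>y = x\<close> shows that \<open>h\<close> extends
  \<open>g\<close>. The extension serves points outside the set on which \<open>g\<close> is known
  to be Lipschitz.\<close>

lemma lipschitz_measurable_extension:
  assumes A: "A \<subseteq> space (Rsp p)" "A \<noteq> {}" and lip: "l2_lipschitz_on p L A g"
  shows "\<exists>h\<in>borel_measurable (Rsp p).
    \<forall>y\<in>space (Rsp p). \<forall>x\<in>A. \<bar>h y - g x\<bar> \<le> L * l2dist p y x"
proof -
  have L: "0 \<le> L" and gl: "\<And>x y. x \<in> A \<Longrightarrow> y \<in> A \<Longrightarrow> \<bar>g x - g y\<bar> \<le> L * l2dist p x y"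
    using lip unfolding l2_lipschitz_on_def by auto
  obtain D where D: "D \<subseteq> A" "countable D" "\<And>x \<eta>. x \<in> A \<Longrightarrow> \<eta> > 0 \<Longrightarrow> \<exists>q\<in>D. l2dist p x q < \<eta>"
    using countable_dense_subset[of A p] by blast
  have ne: "D \<noteq> {}" using D(3)[of _ 1] A(2) by fastforce
  define h where "h y = (INF q\<in>D. g q + L * l2dist p y q)" for y
  have low: "g x - L * l2dist p y x \<le> g q + L * l2dist p y q" if "x \<in> A" "q \<in> D" for x y q
  proof -
    have "g x - g q \<le> L * l2dist p x q" using gl[of x q] that D(1) by force
    also have "\<dots> \<le> L * (l2dist p y x + l2dist p y q)"
      using L l2dist_triangle[of p x q y] by (intro mult_left_mono) (auto simp: l2dist_commute[of p x y])
    finally show ?thesis by (simp add: algebra_simps)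
  qed
  obtain x0 where x0: "x0 \<in> A" using A(2) by auto
  have bdd: "bdd_below ((\<lambda>q. g q + L * l2dist p y q) ` D)" for y
    using low[OF x0] by (intro bdd_belowI2)
  have "h \<in> borel_measurable (Rsp p)"
    unfolding h_def
  proof (rule borel_measurable_cINF)
    fix q assume "q \<in> D"
    then have [measurable]: "q \<in> space (Rsp p)" using D A by auto
    show "(\<lambda>y. g q + L * l2dist p y q) \<in> borel_measurable (Rsp p)" by measurable
  qed (use bdd D in auto)
  moreover have "\<bar>h y - g x\<bar> \<le> L * l2dist p y x" if x: "x \<in> A" for x y
  proof -
    have "g x - L * l2dist p y x \<le> h y"
      unfolding h_def using low[OF x] ne by (intro cINF_greatest) auto
    moreover have "h y \<le> g x + L * l2dist p y x"
    proof (rule field_le_epsilon)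
      fix e :: real assume e: "e > 0"
      \<comment> \<open>Replacing \<open>q\<close> by \<open>x\<close> costs
        \<open>L * l2dist p x q\<close> twice, once in the value of \<open>g\<close> and once in the
        distance to \<open>y\<close>. The summand 1 covers \<open>L = 0\<close>.\<close>
      define \<eta> where "\<eta> = e / (2 * L + 1)"
      have \<eta>: "\<eta> > 0" unfolding \<eta>_def using e L by simp
      obtain q where q: "q \<in> D" "l2dist p x q < \<eta>" using D(3)[OF x \<eta>] by auto
      have "h y \<le> g q + L * l2dist p y q" unfolding h_def by (rule cINF_lower[OF bdd q(1)])
      moreover have "g q \<le> g x + L * l2dist p x q" using gl[of x q] x q D(1) by force
      moreover have "L * l2dist p y q \<le> L * (l2dist p y x + l2dist p x q)"
        using L by (intro mult_left_mono l2dist_triangle)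
      moreover have "2 * L * l2dist p x q \<le> 2 * L * \<eta>" using q(2) L by (intro mult_left_mono) auto
      moreover have "2 * L * \<eta> \<le> e"
        unfolding \<eta>_def using L e by (simp add: divide_simps mult_right_mono)
      ultimately show "h y \<le> g x + L * l2dist p y x + e" by (simp add: algebra_simps)
    qed
    ultimately show ?thesis by simp
  qed
  ultimately show ?thesis by blast
qed

text \<open>Outside the support, a point lies in a null ball with rational centre and radius
  \<open>1 / real (Suc n)\<close>. There are countably many such balls, so their union is
  null.\<close>

lemma AE_law_support:
  assumes "finite_measure M" and V: "V \<in> measurable M (Rsp p)"
  shows "AE \<omega> in M. V \<omega> \<in> law_support M p V"
proof -
  interpret finite_measure M by fact
  note [measurable] = V
  let ?B = "\<lambda>z \<rho>. {\<omega> \<in> space M. l2dist p (V \<omega>) z < \<rho>}"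
  have ball [measurable]: "?B z \<rho> \<in> sets M" if [measurable]: "z \<in> space (Rsp p)" for z \<rho>
    by measurable
  have "AE \<omega> in M. measure M (?B q (1 / real (Suc n))) = 0 \<longrightarrow> \<omega> \<notin> ?B q (1 / real (Suc n))"
    if q: "q \<in> rational_points p" for q n
  proof (cases "measure M (?B q (1 / real (Suc n))) = 0")
    case True
    then have "?B q (1 / real (Suc n)) \<in> null_sets M"
      using ball[of q "1 / real (Suc n)"] q rational_points_subset[of p]
      by (auto simp: null_sets_def emeasure_eq_measure simp del: of_nat_Suc)
    then show ?thesis by (rule AE_not_in[THEN AE_mp]) simp
  qed simp
  then have "AE \<omega> in M. \<forall>q\<in>rational_points p. \<forall>n.
      measure M (?B q (1 / real (Suc n))) = 0 \<longrightarrow> \<omega> \<notin> ?B q (1 / real (Suc n))"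
    unfolding AE_ball_countable[OF countable_rational_points] AE_all_countable by blast
  then show ?thesis
  proof (rule AE_mp, intro AE_I2 impI)
    fix \<omega> assume \<omega>: "\<omega> \<in> space M" and H: "\<forall>q\<in>rational_points p. \<forall>n.
      measure M (?B q (1 / real (Suc n))) = 0 \<longrightarrow> \<omega> \<notin> ?B q (1 / real (Suc n))"
    show "V \<omega> \<in> law_support M p V"
      unfolding law_support_def
    proof (intro CollectI conjI allI impI)
      show V\<omega>: "V \<omega> \<in> space (Rsp p)" using measurable_space[OF V \<omega>] .
      fix \<rho> :: real assume \<rho>: "\<rho> > 0"
      obtain n where n: "1 / real (Suc n) < \<rho> / 2" using nat_approx_posE[of "\<rho> / 2"] \<rho> by auto
      obtain q where q: "q \<in> rational_points p" "l2dist p (V \<omega>) q < 1 / real (Suc n)"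
        using rational_points_dense[of "1 / real (Suc n)" p "V \<omega>"] by auto
      have "?B q (1 / real (Suc n)) \<subseteq> ?B (V \<omega>) \<rho>"
      proof safe
        fix \<omega>' assume "l2dist p (V \<omega>') q < 1 / real (Suc n)"
        then show "l2dist p (V \<omega>') (V \<omega>) < \<rho>"
          using l2dist_triangle[of p "V \<omega>'" "V \<omega>" q] q(2) n l2dist_commute[of p q] by simp
      qed
      then have "measure M (?B q (1 / real (Suc n))) \<le> measure M (?B (V \<omega>) \<rho>)"
        using V\<omega> by (intro finite_measure_mono ball)
      moreover have "measure M (?B q (1 / real (Suc n))) \<noteq> 0"
        using H q \<omega> by auto
      ultimately show "0 < measure M (?B (V \<omega>) \<rho>)"
        using measure_nonneg[of M "?B q (1 / real (Suc n))"] by linarith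
    qed
  qed
qed

section \<open>Measurability of projections\<close>

lemma measurable_proj [measurable]:
  assumes "A \<in> carrier_mat d r"
  shows "proj A \<in> measurable (Rsp d) (Rsp r)"
proof -
  have "(\<lambda>x. \<lambda>k\<in>{..<r}. \<Sum>i<d. A $$ (i, k) * x i) \<in> measurable (Rsp d) (Rsp r)"
    by (intro measurable_restrict) measurable
  moreover have "proj A = (\<lambda>x. \<lambda>k\<in>{..<r}. \<Sum>i<d. A $$ (i, k) * x i)"
    using assms by (auto simp: proj_def)
  ultimately show ?thesis by simp
qed

lemma space_mat_space: "space (mat_space d r) = carrier_mat d r"
  unfolding mat_space_def by simp

lemma measurable_mat_space_entry:
  assumes "i < d" "k < r"
  shows "(\<lambda>A. A $$ (i, k)) \<in> borel_measurable (mat_space d r)"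
proof -
  let ?\<phi> = "\<lambda>A. \<lambda>ij\<in>{..<d} \<times> {..<r}. A $$ ij"
  have "?\<phi> \<in> measurable (mat_space d r) (PiM ({..<d} \<times> {..<r}) (\<lambda>_. borel))"
    unfolding mat_space_def by (intro measurable_vimage_algebra1) (auto simp: space_PiM)
  from measurable_compose[OF this measurable_component_singleton[of "(i, k)"]] assms
  show ?thesis by simp
qed

text \<open>Joint measurability in the matrix and the point is required because the estimated matrix
  is random.\<close>

lemma measurable_proj_pair:
  "(\<lambda>(A, x). proj A x) \<in> measurable (mat_space d r \<Otimes>\<^sub>M Rsp d) (Rsp r)"
proof -
  have "(\<lambda>p. \<lambda>k\<in>{..<r}. \<Sum>i<d. fst p $$ (i, k) * snd p i)
      \<in> measurable (mat_space d r \<Otimes>\<^sub>M Rsp d) (Rsp r)"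
  proof (intro measurable_restrict borel_measurable_sum borel_measurable_times)
    fix k i assume "k \<in> {..<r}" "i \<in> {..<d}"
    then show "(\<lambda>p. fst p $$ (i, k)) \<in> borel_measurable (mat_space d r \<Otimes>\<^sub>M Rsp d)"
      "(\<lambda>p. snd p i) \<in> borel_measurable (mat_space d r \<Otimes>\<^sub>M Rsp d)"
      using measurable_compose[OF measurable_fst measurable_mat_space_entry]
        measurable_compose[OF measurable_snd measurable_component_singleton] by auto
  qed
  then show ?thesis
    by (rule measurable_cong[THEN iffD1, rotated])
      (auto simp: space_pair_measure space_mat_space proj_def)
qed

section \<open>Conditional expectation as best approximation in mean square\<close>

lemma subalgebra_vimage_algebra:
  assumes "f \<in> measurable M N"
  shows "subalgebra M (vimage_algebra (space M) f N)"
  unfolding subalgebra_def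
proof
  have f: "f \<in> space M \<rightarrow> space N" using measurable_space[OF assms] by auto
  show "sets (vimage_algebra (space M) f N) \<subseteq> sets M"
    unfolding sets_vimage_algebra2[OF f] using assms by auto
qed simp

text \<open>Pythagoras for the orthogonal projection. Since \<open>T\<close> is only integrable, the
  argument is carried out for the bounded difference \<open>D\<close>, whose conditional expectation
  is \<open>m - h\<close> and obeys the same bound; then \<open>m - T\<close> equals
  \<open>m' - D\<close> almost everywhere and all products are integrable.\<close>

lemma (in prob_space) cond_exp_l2_best:
  assumes sub: "subalgebra M F" and T: "integrable M T" and h: "h \<in> borel_measurable F"
    and bd: "AE \<omega> in M. \<bar>h \<omega> - T \<omega>\<bar> \<le> c" and m: "AE \<omega> in M. m \<omega> = real_cond_exp M F T \<omega>"
  shows "(\<integral>\<^sup>+\<omega>. ennreal ((m \<omega> - T \<omega>)\<^sup>2) \<partial>M) \<le> (\<integral>\<^sup>+\<omega>. ennreal ((h \<omega> - T \<omega>)\<^sup>2) \<partial>M)"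
proof -
  interpret finite_measure_subalgebra M F by unfold_locales (rule sub)
  have hM [measurable]: "h \<in> borel_measurable M" by (rule measurable_from_subalg[OF sub h])
  have [measurable]: "T \<in> borel_measurable M" using T by auto
  define D where "D \<omega> = T \<omega> - h \<omega>" for \<omega>
  have D [measurable]: "D \<in> borel_measurable M" unfolding D_def by measurable
  have bdD: "AE \<omega> in M. \<bar>D \<omega>\<bar> \<le> c" using bd unfolding D_def by (simp add: abs_minus_commute)
  have intD: "integrable M D" by (rule integrable_const_bound[of _ c]) (use bdD in auto)
  have inth: "integrable M h"
  proof -
    have "integrable M (\<lambda>\<omega>. T \<omega> - D \<omega>)" using T intD by simp
    then show ?thesis unfolding D_def by simp
  qed
  define m' where "m' = real_cond_exp M F D"
  have m'F [measurable]: "m' \<in> borel_measurable F" "m' \<in> borel_measurable M"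
    unfolding m'_def by (auto intro: measurable_from_subalg[OF sub])
  have m'_eq: "AE \<omega> in M. m' \<omega> = m \<omega> - h \<omega>"
    using real_cond_exp_diff[OF T inth] real_cond_exp_F_meas[OF inth h] m
    unfolding m'_def D_def by eventually_elim simp
  have "AE \<omega> in M. m' \<omega> \<le> c"
    unfolding m'_def by (rule real_cond_exp_le_c[OF intD]) (use bdD in \<open>auto elim: eventually_mono\<close>)
  moreover have "AE \<omega> in M. m' \<omega> \<ge> - c"
    unfolding m'_def by (rule real_cond_exp_ge_c[OF intD]) (use bdD in \<open>auto elim!: eventually_mono\<close>)
  ultimately have bdm: "AE \<omega> in M. \<bar>m' \<omega>\<bar> \<le> c" by eventually_elim simp
  have prod_bd: "integrable M (\<lambda>\<omega>. f \<omega> * g \<omega>)"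
    if "AE \<omega> in M. \<bar>f \<omega>\<bar> \<le> c" "AE \<omega> in M. \<bar>g \<omega>\<bar> \<le> c"
      "f \<in> borel_measurable M" "g \<in> borel_measurable M" for f g :: "'a \<Rightarrow> real"
  proof (rule integrable_const_bound[of _ "c * c"])
    show "AE \<omega> in M. norm (f \<omega> * g \<omega>) \<le> c * c"
      using that(1,2) by eventually_elim (auto simp: abs_mult intro!: mult_mono)
  qed (use that in auto)
  note ints = prod_bd[OF bdm bdD m'F(2) D] prod_bd[OF bdm bdm m'F(2) m'F(2)] prod_bd[OF bdD bdD D D]
  \<comment> \<open>The orthogonality relation: \<open>D - m'\<close> is orthogonal to the
    \<open>F\<close>-measurable function \<open>m'\<close>.\<close>
  have cross: "(\<integral>\<omega>. m' \<omega> * m' \<omega> \<partial>M) = (\<integral>\<omega>. m' \<omega> * D \<omega> \<partial>M)"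
    using real_cond_exp_intg(2)[OF ints(1) m'F(1) D] unfolding m'_def by simp
  have sq: "integrable M (\<lambda>\<omega>. (m' \<omega> - D \<omega>)\<^sup>2)" "integrable M (\<lambda>\<omega>. (D \<omega>)\<^sup>2)"
  proof -
    have "(\<lambda>\<omega>. (m' \<omega> - D \<omega>)\<^sup>2) = (\<lambda>\<omega>. m' \<omega> * m' \<omega> - 2 * (m' \<omega> * D \<omega>) + D \<omega> * D \<omega>)"
      by (auto simp: power2_eq_square algebra_simps)
    then show "integrable M (\<lambda>\<omega>. (m' \<omega> - D \<omega>)\<^sup>2)" using ints by simp
    show "integrable M (\<lambda>\<omega>. (D \<omega>)\<^sup>2)" using ints by (simp add: power2_eq_square)
  qed
  have "(\<integral>\<omega>. (m' \<omega> - D \<omega>)\<^sup>2 \<partial>M) =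
      (\<integral>\<omega>. m' \<omega> * m' \<omega> - 2 * (m' \<omega> * D \<omega>) + D \<omega> * D \<omega> \<partial>M)"
    by (auto simp: power2_eq_square algebra_simps)
  also have "\<dots> = (\<integral>\<omega>. (D \<omega>)\<^sup>2 \<partial>M) - (\<integral>\<omega>. m' \<omega> * m' \<omega> \<partial>M)"
    using ints cross by (simp add: power2_eq_square)
  also have "\<dots> \<le> (\<integral>\<omega>. (D \<omega>)\<^sup>2 \<partial>M)" by simp
  finally have le: "(\<integral>\<omega>. (m' \<omega> - D \<omega>)\<^sup>2 \<partial>M) \<le> (\<integral>\<omega>. (D \<omega>)\<^sup>2 \<partial>M)" .
  have "(\<integral>\<^sup>+\<omega>. ennreal ((m \<omega> - T \<omega>)\<^sup>2) \<partial>M) = (\<integral>\<^sup>+\<omega>. ennreal ((m' \<omega> - D \<omega>)\<^sup>2) \<partial>M)"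
    using m'_eq by (intro nn_integral_cong_AE) (auto simp: D_def elim!: eventually_mono)
  also have "\<dots> = ennreal (\<integral>\<omega>. (m' \<omega> - D \<omega>)\<^sup>2 \<partial>M)"
    using sq(1) by (intro nn_integral_eq_integral) auto
  also have "\<dots> \<le> ennreal (\<integral>\<omega>. (D \<omega>)\<^sup>2 \<partial>M)" using le by (rule ennreal_leI)
  also have "\<dots> = (\<integral>\<^sup>+\<omega>. ennreal ((D \<omega>)\<^sup>2) \<partial>M)"
    using sq(2) by (intro nn_integral_eq_integral[symmetric]) auto
  also have "\<dots> = (\<integral>\<^sup>+\<omega>. ennreal ((h \<omega> - T \<omega>)\<^sup>2) \<partial>M)"
    unfolding D_def by (simp add: power2_commute)
  finally show ?thesis .
qed

section \<open>Gradients of ridge functions\<close>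

lemma has_gradient_directional:
  fixes w :: "nat \<Rightarrow> real"
  assumes hg: "has_gradient d f x v" and e: "e > 0"
  shows "\<exists>t0>0. \<forall>t. 0 < t \<and> t < t0 \<longrightarrow>
    \<bar>f (\<lambda>i\<in>{..<d}. x i + t * w i) - f x - t * (\<Sum>i<d. v i * w i)\<bar> \<le> e * (t * L2_set w {..<d})"
proof -
  obtain \<delta> where \<delta>: "\<delta> > 0" "\<And>y. y \<in> space (Rsp d) \<Longrightarrow> l2dist d y x < \<delta> \<Longrightarrow>
      \<bar>f y - f x - (\<Sum>i<d. v i * (y i - x i))\<bar> \<le> e * l2dist d y x"
    using hg e unfolding has_gradient_def by blast
  let ?N = "L2_set w {..<d}"
  have N: "0 \<le> ?N" by (rule L2_set_nonneg)
  show ?thesis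
  \<comment> \<open>The summand 1 keeps the radius meaningful for \<open>w = 0\<close>.\<close>
  proof (intro exI[of _ "\<delta> / (?N + 1)"] conjI allI impI)
    show "\<delta> / (?N + 1) > 0" using \<delta>(1) N by (intro divide_pos_pos) linarith+
    fix t assume t: "0 < t \<and> t < \<delta> / (?N + 1)"
    let ?y = "\<lambda>i\<in>{..<d}. x i + t * w i"
    have "l2dist d ?y x = L2_set (\<lambda>i. t * w i) {..<d}"
      unfolding l2dist_def by (intro L2_set_cong) auto
    also have "\<dots> = t * ?N" using t by (simp add: L2_set_right_distrib)
    finally have dist: "l2dist d ?y x = t * ?N" .
    have "t * ?N \<le> t * (?N + 1)" using t by simp
    also have "\<dots> < \<delta>" using t N by (simp add: pos_less_divide_eq)
    finally have "\<bar>f ?y - f x - (\<Sum>i<d. v i * (?y i - x i))\<bar> \<le> e * l2dist d ?y x"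
      using dist by (intro \<delta>(2)) (auto simp: space_Rsp)
    moreover have "(\<Sum>i<d. v i * (?y i - x i)) = t * (\<Sum>i<d. v i * w i)"
      unfolding sum_distrib_left by (intro sum.cong) auto
    ultimately show "\<bar>f ?y - f x - t * (\<Sum>i<d. v i * w i)\<bar> \<le> e * (t * ?N)"
      unfolding dist by simp
  qed
qed

text \<open>Along the line the increment of \<open>f\<close> is 0, so \<open>t\<close> times the
  directional derivative is of smaller order than \<open>t\<close>. This serves both ridge functions
  and the uniqueness of gradients.\<close>

lemma has_gradient_orthogonal:
  fixes w :: "nat \<Rightarrow> real"
  assumes hg: "has_gradient d f x v" and inv: "\<And>t. f (\<lambda>i\<in>{..<d}. x i + t * w i) = f x"
  shows "(\<Sum>i<d. v i * w i) = 0"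
proof -
  let ?s = "\<Sum>i<d. v i * w i" and ?N = "L2_set w {..<d}"
  have "\<bar>?s\<bar> \<le> 0 + \<eta>" if \<eta>: "\<eta> > 0" for \<eta>
  proof -
    have N: "0 \<le> ?N" by (rule L2_set_nonneg)
    obtain t0 where t0: "t0 > 0" "\<And>t. 0 < t \<Longrightarrow> t < t0 \<Longrightarrow>
      \<bar>f (\<lambda>i\<in>{..<d}. x i + t * w i) - f x - t * ?s\<bar> \<le> \<eta> / (?N + 1) * (t * ?N)"
      using has_gradient_directional[OF hg, of "\<eta> / (?N + 1)" w] \<eta> N by auto
    define t where "t = t0 / 2"
    have t: "0 < t" "t < t0" unfolding t_def using t0(1) by auto
    have "t * \<bar>?s\<bar> \<le> t * (\<eta> * (?N / (?N + 1)))"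
      using t0(2)[OF t] t(1) by (simp add: inv abs_mult ac_simps)
    then have "\<bar>?s\<bar> \<le> \<eta> * (?N / (?N + 1))" using t(1) mult_le_cancel_left_pos by blast
    also have "\<dots> \<le> \<eta> * 1"
    proof (rule mult_left_mono)
      have "0 < ?N + 1" using N by linarith
      then show "?N / (?N + 1) \<le> 1" by (simp add: pos_divide_le_eq)
    qed (use \<eta> in simp)
    finally show ?thesis by simp
  qed
  then have "\<bar>?s\<bar> \<le> 0" by (rule field_le_epsilon)
  then show ?thesis by simp
qed

lemma has_gradient_diff:
  assumes "has_gradient d f x v" "has_gradient d f x v'"
  shows "has_gradient d (\<lambda>_. 0) x (\<lambda>i\<in>{..<d}. v i - v' i)"
  unfolding has_gradient_def
proof (intro conjI allI impI)
  fix e :: real assume e: "e > 0"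
  then have e2: "e / 2 > 0" by simp
  obtain \<delta> where \<delta>: "\<delta> > 0" "\<And>y. y \<in> space (Rsp d) \<Longrightarrow> l2dist d y x < \<delta> \<Longrightarrow>
      \<bar>f y - f x - (\<Sum>i<d. v i * (y i - x i))\<bar> \<le> e / 2 * l2dist d y x"
    using assms(1) e2 unfolding has_gradient_def by blast
  obtain \<delta>' where \<delta>': "\<delta>' > 0" "\<And>y. y \<in> space (Rsp d) \<Longrightarrow> l2dist d y x < \<delta>' \<Longrightarrow>
      \<bar>f y - f x - (\<Sum>i<d. v' i * (y i - x i))\<bar> \<le> e / 2 * l2dist d y x"
    using assms(2) e2 unfolding has_gradient_def by blast
  show "\<exists>\<delta>>0. \<forall>y\<in>space (Rsp d). l2dist d y x < \<delta> \<longrightarrow>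
      \<bar>0 - 0 - (\<Sum>i<d. (\<lambda>i\<in>{..<d}. v i - v' i) i * (y i - x i))\<bar> \<le> e * l2dist d y x"
  proof (intro exI[of _ "min \<delta> \<delta>'"] conjI ballI impI)
    fix y assume y: "y \<in> space (Rsp d)" "l2dist d y x < min \<delta> \<delta>'"
    have eq: "(\<Sum>i<d. (\<lambda>i\<in>{..<d}. v i - v' i) i * (y i - x i))
        = (\<Sum>i<d. v i * (y i - x i)) - (\<Sum>i<d. v' i * (y i - x i))"
      by (simp add: sum_subtractf algebra_simps)
    show "\<bar>0 - 0 - (\<Sum>i<d. (\<lambda>i\<in>{..<d}. v i - v' i) i * (y i - x i))\<bar> \<le> e * l2dist d y x"
    proof -
      have tri: "\<bar>0 - 0 - (b - c)\<bar> \<le> E" if "\<bar>a - b\<bar> \<le> E / 2" "\<bar>a - c\<bar> \<le> E / 2"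
        for a b c E :: real
        using that by arith
      show ?thesis unfolding eq by (rule tri[of "f y - f x"]) (use \<delta>(2)[of y] \<delta>'(2)[of y] y in auto)
    qed
  qed (use \<delta>(1) \<delta>'(1) in simp)
qed (simp add: space_Rsp)

text \<open>The difference of two gradients is a gradient of the zero function, which is constant
  along every line. Tested in its own direction, the difference has squared length 0.\<close>

lemma gradient_eq:
  assumes hg: "has_gradient d f x v"
  shows "gradient d f x = v"
  unfolding gradient_def
proof (rule the_equality[of _ v])
  fix v' assume hg': "has_gradient d f x v'"
  let ?u = "\<lambda>i\<in>{..<d}. v' i - v i"
  have "(\<Sum>i<d. ?u i * ?u i) = 0"
    using has_gradient_orthogonal[OF has_gradient_diff[OF hg' hg]] by simp
  then have "\<forall>i<d. ?u i = 0" by (subst (asm) sum_nonneg_eq_0_iff) auto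
  moreover have "v \<in> space (Rsp d)" "v' \<in> space (Rsp d)" using hg hg' unfolding has_gradient_def by auto
  ultimately show "v' = v" unfolding space_Rsp by (intro PiE_ext) auto
qed (rule hg)

lemma proj_eq_scalar_prod:
  assumes "A \<in> carrier_mat d r" "k < r"
  shows "proj A x k = col A k \<bullet> Matrix.vec d x"
  using assms by (simp add: proj_def scalar_prod_def atLeast0LessThan)

lemma ejop_carrier: "ejop M d f V \<in> carrier_mat d d"
  and ejop_symmetric: "transpose_mat (ejop M d f V) = ejop M d f V"
  unfolding ejop_def by (auto intro!: eq_matI simp: mult.commute)

lemma ejop_estimate_carrier: "ejop_estimate d h F xs J \<in> carrier_mat d d"
  and ejop_estimate_symmetric: "transpose_mat (ejop_estimate d h F xs J) = ejop_estimate d h F xs J"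
  unfolding ejop_estimate_def by (auto intro!: eq_matI simp: mult.commute)

text \<open>Moving along \<open>w\<close> leaves the projection to \<open>U\<close>, and hence
  \<open>f\<close>, unchanged; so the gradient is almost surely orthogonal to \<open>w\<close>. Each
  entry of the product is the mean of a partial derivative times this vanishing scalar
  product.\<close>

lemma ejop_ridge_kernel:
  assumes ex: "ejop_exists M d f V" and V: "\<And>\<omega>. \<omega> \<in> space M \<Longrightarrow> V \<omega> \<in> space (Rsp d)"
    and U: "U \<in> carrier_mat d r" and f: "\<And>x. x \<in> space (Rsp d) \<Longrightarrow> f x = g (proj U x)"
    and w: "w \<in> carrier_vec d" "\<And>k. k < r \<Longrightarrow> col U k \<bullet> w = 0"
  shows "ejop M d f V *\<^sub>v w = 0\<^sub>v d"
proof -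
  have AE0: "AE \<omega> in M. (\<Sum>k<d. gradient d f (V \<omega>) k * w $ k) = 0"
  proof -
    have "AE \<omega> in M. \<exists>v. has_gradient d f (V \<omega>) v" using ex unfolding ejop_exists_def by simp
    then show ?thesis
    proof (rule AE_mp, intro AE_I2 impI)
      fix \<omega> assume \<omega>: "\<omega> \<in> space M" and "\<exists>v. has_gradient d f (V \<omega>) v"
      then obtain v where hg: "has_gradient d f (V \<omega>) v" by auto
      have "(\<Sum>k<d. v k * w $ k) = 0"
      proof (rule has_gradient_orthogonal[OF hg])
        fix t
        let ?y = "\<lambda>i\<in>{..<d}. V \<omega> i + t * w $ i"
        have "proj U ?y k = proj U (V \<omega>) k" for k
        proof (cases "k < r")
          case True
          have "(\<Sum>i<d. U $$ (i, k) * w $ i) = 0"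
            using w True U by (simp add: scalar_prod_def atLeast0LessThan)
          then have "(\<Sum>i<d. U $$ (i, k) * (V \<omega> i + t * w $ i)) = (\<Sum>i<d. U $$ (i, k) * V \<omega> i)"
            by (simp add: algebra_simps sum.distrib flip: sum_distrib_left)
          then show ?thesis using U True by (simp add: proj_def)
        next
          case False
          then show ?thesis using U by (simp add: proj_def)
        qed
        then have "proj U ?y = proj U (V \<omega>)" by (rule ext)
        then show "f ?y = f (V \<omega>)" using f[of ?y] f[OF V[OF \<omega>]] by (simp add: space_Rsp)
      qed
      then show "(\<Sum>k<d. gradient d f (V \<omega>) k * w $ k) = 0" using gradient_eq[OF hg] by simp
    qed
  qed
  show ?thesis
  proof (rule eq_vecI)
    fix j assume "j < dim_vec (0\<^sub>v d)"
    then have j: "j < d" by simp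
    have int: "integrable M (\<lambda>\<omega>. gradient d f (V \<omega>) j * gradient d f (V \<omega>) k)" if "k < d" for k
      using ex j that unfolding ejop_exists_def by simp
    have "(ejop M d f V *\<^sub>v w) $ j
        = (\<Sum>k<d. (\<integral>\<omega>. gradient d f (V \<omega>) j * gradient d f (V \<omega>) k \<partial>M) * w $ k)"
      using j w unfolding ejop_def by (simp add: scalar_prod_def atLeast0LessThan)
    also have "\<dots> = (\<integral>\<omega>. (\<Sum>k<d. gradient d f (V \<omega>) j * gradient d f (V \<omega>) k * w $ k) \<partial>M)"
      using int by (subst Bochner_Integration.integral_sum) auto
    also have "\<dots> = (\<integral>\<omega>. gradient d f (V \<omega>) j * (\<Sum>k<d. gradient d f (V \<omega>) k * w $ k) \<partial>M)"
      by (simp add: sum_distrib_left mult.assoc)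
    also have "\<dots> = 0"
      using AE0 by (intro integral_eq_zero_AE) (auto elim!: eventually_mono)
    finally show "(ejop M d f V *\<^sub>v w) $ j = 0\<^sub>v d $ j" using j by simp
  qed (simp add: ejop_def)
qed

section \<open>Independence of the training data and the fresh point\<close>

context
  fixes M :: "'w measure" and Q :: "'s measure" and d X Y and S :: "'w \<Rightarrow> 's"
  assumes iid: "iid_regression_data M Q d X Y S"
begin

lemma iid_prob_space: "prob_space M"
  using iid unfolding iid_regression_data_def by simp

lemma iid_measurable:
  shows "(\<lambda>\<omega>. (X i \<omega>, Y i \<omega>)) \<in> measurable M (Rsp d \<Otimes>\<^sub>M borel)"
    and "X i \<in> measurable M (Rsp d)" and "Y i \<in> borel_measurable M" and "S \<in> measurable M Q"
proof -
  interpret prob_space M by (rule iid_prob_space)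
  show XY: "(\<lambda>\<omega>. (X i \<omega>, Y i \<omega>)) \<in> measurable M (Rsp d \<Otimes>\<^sub>M borel)"
    using iid unfolding iid_regression_data_def indep_vars_def by auto
  show "X i \<in> measurable M (Rsp d)" "Y i \<in> borel_measurable M"
    using measurable_compose[OF XY measurable_fst] measurable_compose[OF XY measurable_snd] by auto
  show "S \<in> measurable M Q" using iid unfolding iid_regression_data_def by simp
qed

lemma training_tuple_measurable:
  assumes "\<And>i. i \<in> {1..n} \<Longrightarrow> Z i \<in> measurable M (Rsp p)"
  shows "(\<lambda>\<omega>. (\<lambda>i\<in>{1..n}. (Z i \<omega>, Y i \<omega>), S \<omega>))
    \<in> measurable M (PiM {1..n} (\<lambda>_. Rsp p \<Otimes>\<^sub>M borel) \<Otimes>\<^sub>M Q)"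
  using assms iid_measurable(3,4) by (intro measurable_Pair measurable_restrict) auto

lemma subalgebra_training_algebra:
  assumes "\<And>i. i \<in> {1..n} \<Longrightarrow> Z i \<in> measurable M (Rsp p)"
  shows "subalgebra M (training_algebra M Q S p n Z Y)"
  unfolding training_algebra_def
  by (intro subalgebra_vimage_algebra training_tuple_measurable assms)

text \<open>Two facts are combined: the pairs are independent of each other, and the seed is
  independent of all pairs jointly. The product rule is checked on intersection-stable generators,
  with rectangles for the training tuple and the seed, and then extends to the generated
  algebras.\<close>

lemma indep_test_training:
  "prob_space.indep_set M (sets (vimage_algebra (space M) (\<lambda>\<omega>. (X 0 \<omega>, Y 0 \<omega>)) (Rsp d \<Otimes>\<^sub>M borel)))
     (sets (training_algebra M Q S d n X Y))"
proof -
  interpret prob_space M by (rule iid_prob_space)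
  let ?N = "Rsp d \<Otimes>\<^sub>M (borel :: real measure)"
  let ?XY = "\<lambda>i \<omega>. (X i \<omega>, Y i \<omega>)"
  let ?B = "\<lambda>\<omega>. \<lambda>i\<in>{1..n}. ?XY i \<omega>"
  let ?P = "PiM {1..n} (\<lambda>_. ?N)"
  let ?All = "vimage_algebra (space M) (\<lambda>\<omega> i. ?XY i \<omega>) (PiM UNIV (\<lambda>_. ?N))"
  let ?W = "\<lambda>\<omega>. (?B \<omega>, S \<omega>)"
  define G where "G = {?XY 0 -` A \<inter> space M | A. A \<in> sets ?N}"
  define E where "E = {?W -` R \<inter> space M | R. R \<in> {a \<times> s | a s. a \<in> sets ?P \<and> s \<in> sets Q}}"
  have XYm [measurable]: "?XY i \<in> measurable M ?N" for i by (rule iid_measurable)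
  have Bm [measurable]: "?B \<in> measurable M ?P" by (intro measurable_restrict XYm)
  have Sm [measurable]: "S \<in> measurable M Q" by (rule iid_measurable)
  have Wm: "?W \<in> measurable M (?P \<Otimes>\<^sub>M Q)" by measurable
  have iv: "indep_vars (\<lambda>_. ?N) ?XY UNIV"
    and indS: "indep_set (sets ?All) (sets (vimage_algebra (space M) S Q))"
    using iid unfolding iid_regression_data_def by auto
  have All: "(\<lambda>\<omega> i. ?XY i \<omega>) \<in> measurable ?All (PiM UNIV (\<lambda>_. ?N))"
    using measurable_space[OF XYm] by (intro measurable_vimage_algebra1) (auto simp: space_PiM)
  have XYAll: "?XY i \<in> measurable ?All ?N" for i
    using measurable_compose[OF All measurable_component_singleton[of i]] by simp
  have BAll: "?B \<in> measurable ?All ?P" by (intro measurable_restrict XYAll)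
  have split: "prob (A \<inter> (?W -` (a \<times> s) \<inter> space M)) = prob A * prob (?W -` (a \<times> s) \<inter> space M)"
    if A: "A \<in> G" and a: "a \<in> sets ?P" and s: "s \<in> sets Q" for A a s
  proof -
    obtain A' where A': "A' \<in> sets ?N" "A = ?XY 0 -` A' \<inter> space M" using A unfolding G_def by auto
    let ?b = "?B -` a \<inter> space M" and ?s = "S -` s \<inter> space M"
    have sS: "?s \<in> sets (vimage_algebra (space M) S Q)" by (rule in_vimage_algebra[OF s])
    have bAll: "?b \<in> sets ?All" using measurable_sets[OF BAll a] by simp
    have AAll: "A \<in> sets ?All" using measurable_sets[OF XYAll A'(1), of 0] A'(2) by simp
    have W: "?W -` (a \<times> s) \<inter> space M = ?b \<inter> ?s" by auto
    \<comment> \<open>Independence of blocks is a statement about families, so the fresh pair is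
      regarded as a family over the index set \<open>{0}\<close>.\<close>
    have iv0: "indep_var (PiM {0} (\<lambda>_. ?N)) (\<lambda>\<omega>. restrict (\<lambda>i. ?XY i \<omega>) {0}) ?P ?B"
      using iv by (rule indep_var_restrict) auto
    let ?A0 = "(\<lambda>f. f 0) -` A' \<inter> space (PiM {0::nat} (\<lambda>_. ?N))"
    have A0: "?A0 \<in> sets (PiM {0} (\<lambda>_. ?N))"
      using measurable_sets[OF measurable_component_singleton[of 0 "{0::nat}" "\<lambda>_. ?N"] A'(1)] by simp
    have A_eq: "(\<lambda>\<omega>. restrict (\<lambda>i. ?XY i \<omega>) {0}) -` ?A0 \<inter> space M = A"
      unfolding A'(2) using measurable_space[OF XYm] by (auto simp: space_PiM)
    have "prob (A \<inter> ?b) = prob A * prob ?b"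
      using indep_varD[OF iv0 A0 a] unfolding A_eq[symmetric]
      by (simp add: vimage_def Int_def conj_ac)
    \<comment> \<open>The set \<open>A \<inter> ?b\<close> is an event of the pairs alone, so the
      seed splits off first; the fresh pair is then separated from the training pairs.\<close>
    moreover have "prob ((A \<inter> ?b) \<inter> ?s) = prob (A \<inter> ?b) * prob ?s"
      using AAll bAll by (intro indep_setD[OF indS] sS) auto
    moreover have "prob (?b \<inter> ?s) = prob ?b * prob ?s" by (intro indep_setD[OF indS] sS bAll)
    ultimately show ?thesis unfolding W by (simp add: Int_assoc)
  qed
  have "indep_set G E"
    unfolding indep_sets2_eq
  proof (intro conjI ballI)
    show "G \<subseteq> events" unfolding G_def by auto
    show "E \<subseteq> events" unfolding E_def using Wm by (auto intro!: measurable_sets[OF Wm])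
    fix A R assume "A \<in> G" "R \<in> E"
    then show "prob (A \<inter> R) = prob A * prob R" unfolding E_def using split by auto
  qed
  moreover have "Int_stable G"
    unfolding Int_stable_def G_def
  proof safe
    fix A A' assume "A \<in> sets ?N" "A' \<in> sets ?N"
    then show "\<exists>C. (?XY 0 -` A \<inter> space M) \<inter> (?XY 0 -` A' \<inter> space M) = ?XY 0 -` C \<inter> space M \<and> C \<in> sets ?N"
      by (intro exI[of _ "A \<inter> A'"]) auto
  qed
  moreover have "Int_stable E"
    unfolding Int_stable_def
  proof (intro ballI)
    fix R R' assume "R \<in> E" "R' \<in> E"
    then obtain a s a' s' where "R = ?W -` (a \<times> s) \<inter> space M" "R' = ?W -` (a' \<times> s') \<inter> space M"
      "a \<in> sets ?P" "s \<in> sets Q" "a' \<in> sets ?P" "s' \<in> sets Q" unfolding E_def by blast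
    then have "R \<inter> R' = ?W -` ((a \<inter> a') \<times> (s \<inter> s')) \<inter> space M" "a \<inter> a' \<in> sets ?P" "s \<inter> s' \<in> sets Q"
      by auto
    then show "R \<inter> R' \<in> E" unfolding E_def by blast
  qed
  ultimately have "indep_set (sigma_sets (space M) G) (sigma_sets (space M) E)"
    by (rule indep_set_sigma_sets)
  moreover have "sets (vimage_algebra (space M) (?XY 0) ?N) = sigma_sets (space M) G"
    unfolding sets_vimage_algebra G_def by simp
  moreover have "sets (training_algebra M Q S d n X Y) = sigma_sets (space M) E"
  proof -
    let ?rect = "{a \<times> s | a s. a \<in> sets ?P \<and> s \<in> sets Q}"
    have "sets (vimage_algebra (space M) ?W (?P \<Otimes>\<^sub>M Q)) =
        sets (vimage_algebra (space M) ?W (sigma (space ?P \<times> space Q) ?rect))"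
      by (intro sets_vimage_algebra_cong) (simp add: sets_pair_measure sets_measure_of pair_measure_closed)
    also have "\<dots> = sets (sigma (space M) E)"
      unfolding E_def using measurable_space[OF Wm]
      by (subst vimage_algebra_sigma) (auto simp: space_pair_measure dest: sets.sets_into_space)
    also have "\<dots> = sigma_sets (space M) E"
      by (rule sets_measure_of) (auto simp: E_def)
    finally show ?thesis unfolding training_algebra_def .
  qed
  ultimately show ?thesis by simp
qed

lemma distr_training_test:
  assumes T: "T \<in> measurable (training_algebra M Q S d n X Y) N"
  shows "distr M N T \<Otimes>\<^sub>M distr M (Rsp d) (X 0) = distr M (N \<Otimes>\<^sub>M Rsp d) (\<lambda>\<omega>. (T \<omega>, X 0 \<omega>))"
proof -
  interpret prob_space M by (rule iid_prob_space)
  have sub: "subalgebra M (training_algebra M Q S d n X Y)"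
    by (rule subalgebra_training_algebra) (rule iid_measurable)
  have sp: "space (training_algebra M Q S d n X Y) = space M" using sub unfolding subalgebra_def by simp
  have TM [measurable]: "T \<in> measurable M N" by (rule measurable_from_subalg[OF sub T])
  have X [measurable]: "X 0 \<in> measurable M (Rsp d)" by (rule iid_measurable)
  let ?F = "vimage_algebra (space M) (\<lambda>\<omega>. (X 0 \<omega>, Y 0 \<omega>)) (Rsp d \<Otimes>\<^sub>M (borel :: real measure))"
  have "(\<lambda>\<omega>. (X 0 \<omega>, Y 0 \<omega>)) \<in> measurable ?F (Rsp d \<Otimes>\<^sub>M borel)"
    using measurable_space[OF iid_measurable(1)[of 0]] by (intro measurable_vimage_algebra1) auto
  from measurable_compose[OF this measurable_fst] have XF: "X 0 \<in> measurable ?F (Rsp d)" by simp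
  interpret DT: prob_space "distr M N T" by (rule prob_space_distr) simp
  interpret DX: prob_space "distr M (Rsp d) (X 0)" by (rule prob_space_distr) simp
  show ?thesis
  proof (rule pair_measure_eqI)
    fix B A assume B: "B \<in> sets (distr M N T)" and A: "A \<in> sets (distr M (Rsp d) (X 0))"
    let ?b = "T -` B \<inter> space M" and ?a = "X 0 -` A \<inter> space M"
    have "?a \<in> sets ?F" using measurable_sets[OF XF, of A] A by simp
    moreover have "?b \<in> sets (training_algebra M Q S d n X Y)"
      using measurable_sets[OF T, of B] B sp by simp
    ultimately have "prob (?a \<inter> ?b) = prob ?a * prob ?b"
      by (rule indep_setD[OF indep_test_training])
    moreover have "(\<lambda>\<omega>. (T \<omega>, X 0 \<omega>)) -` (B \<times> A) \<inter> space M = ?a \<inter> ?b" by auto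
    ultimately show "emeasure (distr M N T) B * emeasure (distr M (Rsp d) (X 0)) A
        = emeasure (distr M (N \<Otimes>\<^sub>M Rsp d) (\<lambda>\<omega>. (T \<omega>, X 0 \<omega>))) (B \<times> A)"
      using A B by (simp add: emeasure_distr emeasure_eq_measure ennreal_mult[symmetric] mult.commute)
  qed (use DT.sigma_finite_measure_axioms DX.sigma_finite_measure_axioms in
      \<open>auto cong: sets_pair_measure_cong\<close>)
qed

text \<open>Fubini for the product law: whatever was learnt from the sample and the seed may be
  frozen while the fresh point is averaged. Bounds valid for each fixed matrix thereby carry over to
  the estimated one.\<close>

lemma nn_integral_training_test:
  assumes T: "T \<in> measurable (training_algebra M Q S d n X Y) N"
    and \<Phi>: "(\<lambda>(v, x). \<Phi> v x) \<in> borel_measurable (N \<Otimes>\<^sub>M Rsp d)"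
  shows "(\<integral>\<^sup>+\<omega>. \<Phi> (T \<omega>) (X 0 \<omega>) \<partial>M) = (\<integral>\<^sup>+\<omega>. (\<integral>\<^sup>+\<omega>'. \<Phi> (T \<omega>) (X 0 \<omega>') \<partial>M) \<partial>M)"
proof -
  interpret prob_space M by (rule iid_prob_space)
  have TM [measurable]: "T \<in> measurable M N"
    by (rule measurable_from_subalg[OF subalgebra_training_algebra T]) (rule iid_measurable)
  have X [measurable]: "X 0 \<in> measurable M (Rsp d)" by (rule iid_measurable)
  note eq = distr_training_test[OF T]
  interpret DX: prob_space "distr M (Rsp d) (X 0)" by (rule prob_space_distr) simp
  have \<Phi>' : "(\<lambda>(v, x). \<Phi> v x) \<in> borel_measurable (N \<Otimes>\<^sub>M distr M (Rsp d) (X 0))"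
    using \<Phi> by simp
  have "(\<integral>\<^sup>+\<omega>. \<Phi> (T \<omega>) (X 0 \<omega>) \<partial>M)
      = (\<integral>\<^sup>+z. (case z of (v, x) \<Rightarrow> \<Phi> v x) \<partial>distr M (N \<Otimes>\<^sub>M Rsp d) (\<lambda>\<omega>. (T \<omega>, X 0 \<omega>)))"
    using \<Phi> by (subst nn_integral_distr) auto
  also have "\<dots> = (\<integral>\<^sup>+v. (\<integral>\<^sup>+x. \<Phi> v x \<partial>distr M (Rsp d) (X 0)) \<partial>distr M N T)"
    unfolding eq[symmetric] using \<Phi>' by (subst DX.nn_integral_fst[symmetric]) auto
  also have "\<dots> = (\<integral>\<^sup>+\<omega>. (\<integral>\<^sup>+x. \<Phi> (T \<omega>) x \<partial>distr M (Rsp d) (X 0)) \<partial>M)"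
    using DX.borel_measurable_nn_integral[OF \<Phi>'] by (subst nn_integral_distr) auto
  also have "\<dots> = (\<integral>\<^sup>+\<omega>. (\<integral>\<^sup>+\<omega>'. \<Phi> (T \<omega>) (X 0 \<omega>') \<partial>M) \<partial>M)"
  proof (intro nn_integral_cong)
    fix \<omega> assume "\<omega> \<in> space M"
    then have "T \<omega> \<in> space N" using measurable_space[OF TM] by simp
    then have "\<Phi> (T \<omega>) \<in> borel_measurable (Rsp d)"
      using measurable_compose[OF measurable_Pair1' \<Phi>] by simp
    then show "(\<integral>\<^sup>+x. \<Phi> (T \<omega>) x \<partial>distr M (Rsp d) (X 0)) = (\<integral>\<^sup>+\<omega>'. \<Phi> (T \<omega>) (X 0 \<omega>') \<partial>M)"
      by (subst nn_integral_distr) auto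
  qed
  finally show ?thesis .
qed

end

section \<open>Consistency of the projected regression\<close>

text \<open>The competitor of \<open>m\<close> extends \<open>g\<close> and is applied to a
  reconstruction of the projection to \<open>U\<close> from the projection to \<open>V\<close>. It
  depends on the projected point only, so it cannot have a smaller mean square error than
  \<open>m\<close>.\<close>

lemma (in prob_space) projected_regression_error:
  assumes X: "X \<in> measurable M (Rsp d)" and f: "regression_function M (Rsp d) X T f"
    and U: "orthonormal_columns d r U" and V: "orthonormal_columns d r V"
    and fg: "\<And>x. x \<in> space (Rsp d) \<Longrightarrow> f x = g (proj U x)"
    and K: "K \<subseteq> space (Rsp d)" "AE \<omega> in M. X \<omega> \<in> K" "\<And>x. x \<in> K \<Longrightarrow> L2_set x {..<d} \<le> R"
    and lip: "l2_lipschitz_on r L (proj U ` K) g"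
    and m: "regression_function M (Rsp r) (\<lambda>\<omega>. proj V (X \<omega>)) T m"
  shows "(\<integral>\<^sup>+\<omega>. ennreal ((m (proj V (X \<omega>)) - f (X \<omega>))\<^sup>2) \<partial>M) \<le> ennreal (L\<^sup>2 * R\<^sup>2 * subspace_gap r U V)"
proof -
  have U': "U \<in> carrier_mat d r" and V': "V \<in> carrier_mat d r"
    using U V unfolding orthonormal_columns_def by auto
  note [measurable] = X measurable_proj[OF U'] measurable_proj[OF V']
  let ?G = "vimage_algebra (space M) X (Rsp d)"
  let ?F = "vimage_algebra (space M) (\<lambda>\<omega>. proj V (X \<omega>)) (Rsp r)"
  have XG: "X \<in> measurable ?G (Rsp d)"
    using measurable_space[OF X] by (intro measurable_vimage_algebra1) auto
  have PX: "(\<lambda>\<omega>. proj V (X \<omega>)) \<in> measurable M (Rsp r)" by measurable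
  have PF: "(\<lambda>\<omega>. proj V (X \<omega>)) \<in> measurable ?F (Rsp r)"
    using measurable_space[OF PX] by (intro measurable_vimage_algebra1) auto
  have subG: "subalgebra M ?G" by (rule subalgebra_vimage_algebra[OF X])
  have subF: "subalgebra M ?F" by (rule subalgebra_vimage_algebra[OF PX])
  have subGF: "subalgebra ?G ?F"
    using subalgebra_vimage_algebra[OF measurable_compose[OF XG measurable_proj[OF V']]] by simp
  interpret G: finite_measure_subalgebra M ?G by unfold_locales (rule subG)
  interpret F: finite_measure_subalgebra M ?F by unfold_locales (rule subF)
  have T: "integrable M T" and fm [measurable]: "f \<in> borel_measurable (Rsp d)"
    and fT: "AE \<omega> in M. f (X \<omega>) = real_cond_exp M ?G T \<omega>"
    using f unfolding regression_function_def by auto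
  have mT: "AE \<omega> in M. m (proj V (X \<omega>)) = real_cond_exp M ?F T \<omega>"
    using m unfolding regression_function_def by auto
  have fX [measurable]: "(\<lambda>\<omega>. f (X \<omega>)) \<in> borel_measurable M" by measurable
  have intG: "integrable M (real_cond_exp M ?G T)" by (rule G.real_cond_exp_int(1)[OF T])
  have intf: "integrable M (\<lambda>\<omega>. f (X \<omega>))"
    by (rule integrable_cong_AE_imp[OF intG fX]) (use fT in \<open>auto elim!: eventually_mono\<close>)
  \<comment> \<open>The tower property: \<open>?F\<close> is coarser than \<open>?G\<close>, so
    \<open>m\<close> is also the conditional expectation of \<open>f (X \<omega>)\<close>, and the
    noise disappears.\<close>
  have "AE \<omega> in M. real_cond_exp M ?F (\<lambda>\<omega>. f (X \<omega>)) \<omega> = real_cond_exp M ?F (real_cond_exp M ?G T) \<omega>"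
    by (rule F.real_cond_exp_cong[OF fT]) (use intG in auto)
  with F.real_cond_exp_nested_subalg[OF subG subGF T] mT
  have mf: "AE \<omega> in M. m (proj V (X \<omega>)) = real_cond_exp M ?F (\<lambda>\<omega>. f (X \<omega>)) \<omega>"
    by eventually_elim simp
  \<comment> \<open>The extension of \<open>g\<close> is an infimum over points of the projected
    set, which must be nonempty.\<close>
  have "K \<noteq> {}"
  proof
    assume "K = {}"
    with K(2) have "AE \<omega> in M. False" by simp
    then show False using AE_False by simp
  qed
  then have ne: "proj U ` K \<noteq> {}" by simp
  have sp: "proj U ` K \<subseteq> space (Rsp r)"
    using K(1) measurable_space[OF measurable_proj[OF U']] by blast
  obtain h where h: "h \<in> borel_measurable (Rsp r)"
    and h_close: "\<forall>y\<in>space (Rsp r). \<forall>z\<in>proj U ` K. \<bar>h y - g z\<bar> \<le> L * l2dist r y z"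
    using lipschitz_measurable_extension[OF sp ne lip] by blast
  define P where "P z = (\<lambda>k\<in>{..<r}. \<Sum>l<r. (col V l \<bullet> col U k) * z l)" for z :: "nat \<Rightarrow> real"
  have P: "P \<in> measurable (Rsp r) (Rsp r)" unfolding P_def by (intro measurable_restrict) measurable
  define c where "c = L\<^sup>2 * R\<^sup>2 * subspace_gap r U V"
  have L: "0 \<le> L" using lip unfolding l2_lipschitz_on_def by simp
  have close: "(h (P (proj V x)) - f x)\<^sup>2 \<le> c" if x: "x \<in> K" for x
  proof -
    have xs: "x \<in> space (Rsp d)" using x K(1) by auto
    let ?x = "Matrix.vec d x"
    have Pk: "P (proj V x) k = (\<Sum>l<r. (col V l \<bullet> col U k) * (col V l \<bullet> ?x))" if "k < r" for k
      using that unfolding P_def by (auto simp: proj_eq_scalar_prod[OF V'])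
    have xx: "?x \<bullet> ?x = (L2_set x {..<d})\<^sup>2"
      by (simp add: scalar_prod_def atLeast0LessThan L2_set_def sum_nonneg power2_eq_square)
    have "(l2dist r (P (proj V x)) (proj U x))\<^sup>2
        = (\<Sum>k<r. (col U k \<bullet> ?x - (\<Sum>l<r. (col V l \<bullet> col U k) * (col V l \<bullet> ?x)))\<^sup>2)"
      unfolding l2dist_def L2_set_def
      by (simp add: sum_nonneg Pk proj_eq_scalar_prod[OF U'] power2_commute)
    also have "\<dots> \<le> (?x \<bullet> ?x) * subspace_gap r U V"
      by (rule subspace_gap_bound[OF U V]) simp
    also have "\<dots> \<le> R\<^sup>2 * subspace_gap r U V"
      unfolding xx using K(3)[OF x] subspace_gap_nonneg[OF U V]
      by (intro mult_right_mono power_mono) auto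
    finally have d2: "(l2dist r (P (proj V x)) (proj U x))\<^sup>2 \<le> R\<^sup>2 * subspace_gap r U V" .
    have "P (proj V x) \<in> space (Rsp r)"
      using measurable_space[OF P] measurable_space[OF measurable_proj[OF V'] xs] by simp
    then have "\<bar>h (P (proj V x)) - f x\<bar> \<le> L * l2dist r (P (proj V x)) (proj U x)"
      using h_close x fg[OF xs] by simp
    then have "(h (P (proj V x)) - f x)\<^sup>2 \<le> (L * l2dist r (P (proj V x)) (proj U x))\<^sup>2"
      by (rule abs_le_square_iff[THEN iffD1, OF order_trans]) simp
    also have "\<dots> \<le> c"
      unfolding c_def using d2 by (simp add: power_mult_distrib mult.assoc mult_left_mono)
    finally show ?thesis .
  qed
  have "(\<integral>\<^sup>+\<omega>. ennreal ((m (proj V (X \<omega>)) - f (X \<omega>))\<^sup>2) \<partial>M)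
      \<le> (\<integral>\<^sup>+\<omega>. ennreal ((h (P (proj V (X \<omega>))) - f (X \<omega>))\<^sup>2) \<partial>M)"
  proof (rule cond_exp_l2_best[OF subF intf _ _ mf])
    show "(\<lambda>\<omega>. h (P (proj V (X \<omega>)))) \<in> borel_measurable ?F"
      by (rule measurable_compose[OF measurable_compose[OF PF P] h])
    show "AE \<omega> in M. \<bar>h (P (proj V (X \<omega>))) - f (X \<omega>)\<bar> \<le> sqrt c"
      using K(2) by (rule eventually_mono) (auto dest!: close intro: real_le_rsqrt simp: power2_abs)
  qed
  also have "\<dots> \<le> (\<integral>\<^sup>+\<omega>. ennreal c \<partial>M)"
    using K(2) by (intro nn_integral_mono_AE) (auto elim!: eventually_mono intro!: ennreal_leI close)
  also have "\<dots> = ennreal c" by (simp add: emeasure_space_1)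
  finally show ?thesis unfolding c_def .
qed

section \<open>The risk of the final forest\<close>

text \<open>The sequence \<open>a\<close> bounds the error of the forest against the projected
  regression function, and \<open>b\<close> the error of the latter against \<open>f\<close>. Twice
  their sum bounds the risk as a nonnegative integral, which also yields integrability.\<close>

lemma jarf_risk_tendsto_zero:
  fixes r :: nat and L R lmin c1 :: real and M :: "'w measure" and Q :: "'s measure"
  assumes r: "1 \<le> r" "r \<le> d"
    and iid: "iid_regression_data M Q d X Y S"
    and U: "orthonormal_columns d r U"
    and reg: "regression_function M (Rsp d) (X 0) (Y 0) f"
    and ridge: "\<forall>x\<in>space (Rsp d). f x = g (proj U x)"
    and K: "compactin (product_topology (\<lambda>_. euclideanreal) {..<d}) K"
      "law_support M d (X 0) \<subseteq> K" "\<forall>x\<in>K. L2_set x {..<d} \<le> R"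
    and lip: "l2_lipschitz_on r L (proj U ` K) g"
    and ejop: "ejop_exists M d f (X 0)"
    and lmin: "lmin > 0" "kth_eigenvalue r (ejop M d f (X 0)) \<ge> lmin"
    and Hhat: "\<forall>n \<omega>. Hhat n \<omega> = ejop_estimate d (h n) (fsur n \<omega>) (\<lambda>i. X i \<omega>) (J n \<omega>)"
    and \<epsilon>: "\<epsilon> \<longlonglongrightarrow> 0" and \<delta>: "\<delta> \<longlonglongrightarrow> 0"
    and close: "\<forall>n\<ge>1. measure M {\<omega> \<in> space M. op_norm (Hhat n \<omega> - ejop M d f (X 0)) \<le> \<epsilon> n} \<ge> 1 - \<delta> n"
    and Uhat: "\<forall>n\<ge>1. Uhat n \<in> measurable (training_algebra M Q S d n X Y) (mat_space d r) \<and>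
         (\<forall>\<omega>\<in>space M. top_eigenvectors d r (Hhat n \<omega>) (Uhat n \<omega>))"
    and Z: "\<forall>n i \<omega>. Z n i \<omega> = proj (Uhat n \<omega>) (X i \<omega>)"
    and mreg: "\<forall>V. orthonormal_columns d r V \<longrightarrow>
         regression_function M (Rsp r) (\<lambda>\<omega>. proj V (X 0 \<omega>)) (Y 0) (mreg V)"
    and mreg_meas: "(\<lambda>(V, z). mreg V z) \<in> borel_measurable (mat_space d r \<Otimes>\<^sub>M Rsp r)"
    and fhat: "\<forall>n\<ge>1. forest_estimator M Q S r n (depth n) (leafsize n) (Z n) Y (fhat n)"
    and cons: "\<exists>e. e \<longlonglongrightarrow> 0 \<and>
         (\<forall>n\<ge>1. AE \<omega> in M.
            nn_cond_exp M (vimage_algebra (space M) (Uhat n) (mat_space d r))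
              (\<lambda>\<omega>. ennreal ((fhat n \<omega> (Z n 0 \<omega>) - mreg (Uhat n \<omega>) (Z n 0 \<omega>))\<^sup>2)) \<omega>
            \<le> ennreal (c1 * real n powr (- 2 / (2 + real r)) + e n))"
  shows "\<forall>n\<ge>1. integrable M (\<lambda>\<omega>. (fhat n \<omega> (Z n 0 \<omega>) - f (X 0 \<omega>))\<^sup>2)"
    and "(\<lambda>n. \<integral>\<omega>. (fhat n \<omega> (Z n 0 \<omega>) - f (X 0 \<omega>))\<^sup>2 \<partial>M) \<longlonglongrightarrow> 0"
proof -
  interpret prob_space M by (rule iid_prob_space[OF iid])
  let ?H = "ejop M d f (X 0)"
  let ?c = "L\<^sup>2 * R\<^sup>2"
  note [measurable] = iid_measurable(2,3)[OF iid]
  have Xs: "X i \<omega> \<in> space (Rsp d)" if "\<omega> \<in> space M" for i \<omega>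
    using measurable_space[OF iid_measurable(2)[OF iid] that] .
  have sub: "subalgebra M (training_algebra M Q S d n X Y)" for n
    by (rule subalgebra_training_algebra[OF iid]) (rule iid_measurable[OF iid])
  have Um [measurable]: "Uhat n \<in> measurable M (mat_space d r)" if "n \<ge> 1" for n
    using measurable_from_subalg[OF sub] Uhat that by blast
  have Uo: "orthonormal_columns d r (Uhat n \<omega>)" if "n \<ge> 1" "\<omega> \<in> space M" for n \<omega>
    using Uhat that unfolding top_eigenvectors_def by blast
  have Zm [measurable]: "Z n i \<in> measurable M (Rsp r)" if [measurable]: "n \<ge> 1" for n i
  proof -
    have "(\<lambda>\<omega>. (Uhat n \<omega>, X i \<omega>)) \<in> measurable M (mat_space d r \<Otimes>\<^sub>M Rsp d)"
      using Um[OF that] by measurable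
    from measurable_compose[OF this measurable_proj_pair]
    have "(\<lambda>\<omega>. proj (Uhat n \<omega>) (X i \<omega>)) \<in> measurable M (Rsp r)" by simp
    then show ?thesis using Z by (simp add: fun_eq_iff[symmetric])
  qed
  have mm: "(\<lambda>\<omega>. mreg (Uhat n \<omega>) (Z n 0 \<omega>)) \<in> borel_measurable M" if "n \<ge> 1" for n
    using measurable_compose[OF measurable_Pair[OF Um[OF that] Zm[OF that]] mreg_meas] by simp
  have fm: "(\<lambda>\<omega>. fhat n \<omega> (Z n 0 \<omega>)) \<in> borel_measurable M" if n: "n \<ge> 1" for n
  proof -
    have subZ: "subalgebra M (training_algebra M Q S r n (Z n) Y)"
      by (rule subalgebra_training_algebra[OF iid]) (rule Zm[OF n])
    have "(\<lambda>(\<omega>, x). fhat n \<omega> x) \<in> borel_measurable (training_algebra M Q S r n (Z n) Y \<Otimes>\<^sub>M Rsp r)"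
      using fhat n unfolding forest_estimator_def by blast
    from measurable_compose[OF measurable_Pair[OF measurable_from_subalg[OF subZ measurable_ident] Zm[OF n, of 0]] this]
    show ?thesis by simp
  qed
  have ff: "(\<lambda>\<omega>. f (X 0 \<omega>)) \<in> borel_measurable M"
    using reg unfolding regression_function_def by (auto intro: measurable_compose)
  obtain e where e: "e \<longlonglongrightarrow> 0" "\<And>n. n \<ge> 1 \<Longrightarrow> AE \<omega> in M.
      nn_cond_exp M (vimage_algebra (space M) (Uhat n) (mat_space d r))
        (\<lambda>\<omega>. ennreal ((fhat n \<omega> (Z n 0 \<omega>) - mreg (Uhat n \<omega>) (Z n 0 \<omega>))\<^sup>2)) \<omega>
      \<le> ennreal (c1 * real n powr (- 2 / (2 + real r)) + e n)"
    using cons by blast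
  \<comment> \<open>Negative reals become 0 under \<open>ennreal\<close>, so the truncation does not
    weaken the assumed bound and makes \<open>a\<close> nonnegative.\<close>
  define a where "a n = max 0 (c1 * real n powr (- 2 / (2 + real r)) + e n)" for n
  have fit: "(\<integral>\<^sup>+\<omega>. ennreal ((fhat n \<omega> (Z n 0 \<omega>) - mreg (Uhat n \<omega>) (Z n 0 \<omega>))\<^sup>2) \<partial>M) \<le> ennreal (a n)"
    (is "(\<integral>\<^sup>+\<omega>. ?g \<omega> \<partial>M) \<le> _") if n: "n \<ge> 1" for n
  proof -
    let ?F = "vimage_algebra (space M) (Uhat n) (mat_space d r)"
    interpret F: finite_measure_subalgebra M ?F
      by unfold_locales (rule subalgebra_vimage_algebra[OF Um[OF n]])
    have gm: "?g \<in> borel_measurable M" using fm[OF n] mm[OF n] by measurable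
    have "(\<integral>\<^sup>+\<omega>. ?g \<omega> \<partial>M) = (\<integral>\<^sup>+\<omega>. nn_cond_exp M ?F ?g \<omega> \<partial>M)"
      using F.nn_cond_exp_intg[of "\<lambda>_. 1", OF _ gm] by simp
    also have "\<dots> \<le> (\<integral>\<^sup>+\<omega>. ennreal (a n) \<partial>M)"
      using e(2)[OF n] unfolding a_def
      by (intro nn_integral_mono_AE) (auto elim!: eventually_mono simp: max_def ennreal_neg)
    finally show ?thesis by (simp add: emeasure_space_1)
  qed
  have K': "K \<subseteq> space (Rsp d)" using compactin_subset_topspace[OF K(1)] by (simp add: space_Rsp)
  have XK: "AE \<omega> in M. X 0 \<omega> \<in> K"
    using AE_law_support[OF finite_measure_axioms iid_measurable(2)[OF iid, of 0]] K(2)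
    by (auto elim!: eventually_mono)
  have proj_err: "(\<integral>\<^sup>+\<omega>. ennreal ((mreg V (proj V (X 0 \<omega>)) - f (X 0 \<omega>))\<^sup>2) \<partial>M)
      \<le> ennreal (?c * subspace_gap r U V)" if V: "orthonormal_columns d r V" for V
    using projected_regression_error[OF iid_measurable(2)[OF iid] reg U V _ K' XK _ lip] ridge K(3) mreg V
    by blast
  have split: "(\<integral>\<^sup>+\<omega>. ennreal ((mreg (Uhat n \<omega>) (Z n 0 \<omega>) - f (X 0 \<omega>))\<^sup>2) \<partial>M)
      \<le> (\<integral>\<^sup>+\<omega>. ennreal (?c * subspace_gap r U (Uhat n \<omega>)) \<partial>M)" if n: "n \<ge> 1" for n
  proof -
    \<comment> \<open>The estimate \<open>Uhat n\<close> is measurable for the training algebra, so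
      it can be frozen in \<Phi> and \<open>proj_err\<close> applied to each of its values.\<close>
    define \<Phi> where "\<Phi> V x = ennreal ((mreg V (proj V x) - f x)\<^sup>2)" for V x
    have "(\<lambda>p. (fst p, proj (fst p) (snd p))) \<in> measurable (mat_space d r \<Otimes>\<^sub>M Rsp d) (mat_space d r \<Otimes>\<^sub>M Rsp r)"
      using measurable_proj_pair[of d r] by (intro measurable_Pair) (auto simp: case_prod_beta')
    from measurable_compose[OF this mreg_meas]
    have [measurable]: "(\<lambda>p. mreg (fst p) (proj (fst p) (snd p))) \<in> borel_measurable (mat_space d r \<Otimes>\<^sub>M Rsp d)"
      by simp
    have [measurable]: "f \<in> borel_measurable (Rsp d)" using reg unfolding regression_function_def by simp
    have \<Phi>: "(\<lambda>(V, x). \<Phi> V x) \<in> borel_measurable (mat_space d r \<Otimes>\<^sub>M Rsp d)"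
      unfolding \<Phi>_def case_prod_beta' by measurable
    have "(\<integral>\<^sup>+\<omega>. \<Phi> (Uhat n \<omega>) (X 0 \<omega>) \<partial>M) = (\<integral>\<^sup>+\<omega>. (\<integral>\<^sup>+\<omega>'. \<Phi> (Uhat n \<omega>) (X 0 \<omega>') \<partial>M) \<partial>M)"
      using nn_integral_training_test[OF iid _ \<Phi>] Uhat n by blast
    also have "\<dots> \<le> (\<integral>\<^sup>+\<omega>. ennreal (?c * subspace_gap r U (Uhat n \<omega>)) \<partial>M)"
      unfolding \<Phi>_def by (intro nn_integral_mono proj_err Uo[OF n])
    finally show ?thesis unfolding \<Phi>_def using Z by simp
  qed
  define q where "q n = real r * (\<epsilon> n / (lmin - \<epsilon> n))\<^sup>2" for n
  \<comment> \<open>The perturbation bound is available only if \<epsilon> \<open>n < lmin\<close>,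
    and the good event has positive guaranteed probability only if \<delta> \<open>n < 1\<close>.
    Both conditions hold eventually; for the other \<open>n\<close> a finite bound suffices.\<close>
  define b where "b n = (if \<delta> n < 1 \<and> \<epsilon> n < lmin then ?c * q n + ?c * real r * \<delta> n else ?c * real r)" for n
  have c: "0 \<le> ?c" by simp
  have gap_r: "?c * subspace_gap r U V \<le> ?c * real r" for V
    by (intro mult_left_mono subspace_gap_le) simp
  have approx: "0 \<le> b n \<and>
      (\<integral>\<^sup>+\<omega>. ennreal ((mreg (Uhat n \<omega>) (Z n 0 \<omega>) - f (X 0 \<omega>))\<^sup>2) \<partial>M) \<le> ennreal (b n)" if n: "n \<ge> 1" for n
  proof (cases "\<delta> n < 1 \<and> \<epsilon> n < lmin")
    case True
    define E where "E = {\<omega> \<in> space M. op_norm (Hhat n \<omega> - ?H) \<le> \<epsilon> n}"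
    have E: "1 - \<delta> n \<le> measure M E" unfolding E_def using close n by blast
    \<comment> \<open>Measurability of the good event is not among the hypotheses. It follows
      because a set outside the algebra would have \<open>measure\<close> 0, whereas the bound
      \<open>1 - \<delta> n\<close> is positive.\<close>
    then have Em [measurable]: "E \<in> sets M" using measure_notin_sets True by fastforce
    have compl: "measure M (space M - E) \<le> \<delta> n" using E prob_compl[OF Em] by simp
    then have \<delta>0: "0 \<le> \<delta> n" using measure_nonneg order_trans by blast
    have gap: "subspace_gap r U (Uhat n \<omega>) \<le> q n" if \<omega>: "\<omega> \<in> E" for \<omega>
      unfolding q_def
    proof (rule subspace_gap_davis_kahan[OF _ _ ejop_carrier ejop_symmetric U])
      show "Hhat n \<omega> \<in> carrier_mat d d" "transpose_mat (Hhat n \<omega>) = Hhat n \<omega>"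
        using Hhat ejop_estimate_carrier ejop_estimate_symmetric by auto
      show "top_eigenvectors d r (Hhat n \<omega>) (Uhat n \<omega>)" using Uhat n \<omega> unfolding E_def by blast
      show "ejop M d f (X 0) *\<^sub>v w = 0\<^sub>v d" if "w \<in> carrier_vec d" "\<forall>k<r. col U k \<bullet> w = 0" for w
        using U that ridge unfolding orthonormal_columns_def
        by (intro ejop_ridge_kernel[OF ejop Xs]) auto
    qed (use lmin r True \<omega> in \<open>auto simp: E_def\<close>)
    have "(\<integral>\<^sup>+\<omega>. ennreal (?c * subspace_gap r U (Uhat n \<omega>)) \<partial>M)
        \<le> (\<integral>\<^sup>+\<omega>. ennreal (?c * q n) + ennreal (?c * real r) * indicator (space M - E) \<omega> \<partial>M)"
    proof (intro nn_integral_mono)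
      fix \<omega> assume \<omega>: "\<omega> \<in> space M"
      show "ennreal (?c * subspace_gap r U (Uhat n \<omega>))
          \<le> ennreal (?c * q n) + ennreal (?c * real r) * indicator (space M - E) \<omega>"
      proof (cases "\<omega> \<in> E")
        case True
        then show ?thesis using mult_left_mono[OF gap[OF True] c] by (simp add: ennreal_leI)
      next
        case False
        then show ?thesis using \<omega> gap_r by (simp add: ennreal_leI add_increasing)
      qed
    qed
    also have "\<dots> = ennreal (?c * q n) + ennreal (?c * real r) * emeasure M (space M - E)"
      by (simp add: nn_integral_add nn_integral_cmult emeasure_space_1)
    also have "\<dots> = ennreal (?c * q n + ?c * real r * measure M (space M - E))"
      unfolding emeasure_eq_measure q_def by (subst ennreal_plus) (auto simp: ennreal_mult)
    also have "\<dots> \<le> ennreal (b n)"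
      unfolding b_def using True compl by (intro ennreal_leI) (auto intro!: mult_left_mono)
    finally show ?thesis using split[OF n] True \<delta>0 unfolding b_def q_def by (auto intro: order_trans)
  next
    case False
    have "(\<integral>\<^sup>+\<omega>. ennreal (?c * subspace_gap r U (Uhat n \<omega>)) \<partial>M) \<le> (\<integral>\<^sup>+\<omega>. ennreal (?c * real r) \<partial>M)"
      by (intro nn_integral_mono ennreal_leI gap_r)
    then show ?thesis using split[OF n] False unfolding b_def by (auto simp: emeasure_space_1 intro: order_trans)
  qed
  let ?risk = "\<lambda>n \<omega>. (fhat n \<omega> (Z n 0 \<omega>) - f (X 0 \<omega>))\<^sup>2"
  have a0: "0 \<le> a n" for n unfolding a_def by simp
  have total: "(\<integral>\<^sup>+\<omega>. ennreal (?risk n \<omega>) \<partial>M) \<le> ennreal (2 * a n + 2 * b n)" if n: "n \<ge> 1" for n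
  proof -
    let ?g1 = "\<lambda>\<omega>. (fhat n \<omega> (Z n 0 \<omega>) - mreg (Uhat n \<omega>) (Z n 0 \<omega>))\<^sup>2"
    let ?g2 = "\<lambda>\<omega>. (mreg (Uhat n \<omega>) (Z n 0 \<omega>) - f (X 0 \<omega>))\<^sup>2"
    have [measurable]: "?g1 \<in> borel_measurable M" "?g2 \<in> borel_measurable M"
      using fm[OF n] mm[OF n] ff by measurable
    have le: "(x - z)\<^sup>2 \<le> 2 * (x - y)\<^sup>2 + 2 * (y - z)\<^sup>2" for x y z :: real
      using zero_le_power2[of "(x - y) - (y - z)"] by (simp add: power2_eq_square algebra_simps)
    have "(\<integral>\<^sup>+\<omega>. ennreal (?risk n \<omega>) \<partial>M) \<le> (\<integral>\<^sup>+\<omega>. 2 * ennreal (?g1 \<omega>) + 2 * ennreal (?g2 \<omega>) \<partial>M)"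
    proof (intro nn_integral_mono)
      fix \<omega>
      have "ennreal (?risk n \<omega>) \<le> ennreal (2 * ?g1 \<omega> + 2 * ?g2 \<omega>)" by (intro ennreal_leI le)
      then show "ennreal (?risk n \<omega>) \<le> 2 * ennreal (?g1 \<omega>) + 2 * ennreal (?g2 \<omega>)"
        by (simp add: ennreal_plus ennreal_mult)
    qed
    also have "\<dots> = 2 * (\<integral>\<^sup>+\<omega>. ennreal (?g1 \<omega>) \<partial>M) + 2 * (\<integral>\<^sup>+\<omega>. ennreal (?g2 \<omega>) \<partial>M)"
      by (simp add: nn_integral_add nn_integral_cmult)
    also have "\<dots> \<le> 2 * ennreal (a n) + 2 * ennreal (b n)"
      using fit[OF n] approx[OF n] by (intro add_mono mult_left_mono) auto
    also have "\<dots> = ennreal (2 * a n + 2 * b n)"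
      using a0 approx[OF n] by (simp add: ennreal_plus ennreal_mult)
    finally show ?thesis .
  qed
  have int: "integrable M (?risk n)" if n: "n \<ge> 1" for n
  proof (rule integrableI_nonneg)
    show "?risk n \<in> borel_measurable M" using fm[OF n] ff by measurable
    show "(\<integral>\<^sup>+\<omega>. ennreal (?risk n \<omega>) \<partial>M) < \<infinity>"
      using total[OF n] by (rule le_less_trans) simp
  qed simp
  then show "\<forall>n\<ge>1. integrable M (?risk n)" by blast
  have bound: "(\<integral>\<omega>. ?risk n \<omega> \<partial>M) \<le> 2 * a n + 2 * b n" if n: "n \<ge> 1" for n
  proof -
    have "ennreal (\<integral>\<omega>. ?risk n \<omega> \<partial>M) = (\<integral>\<^sup>+\<omega>. ennreal (?risk n \<omega>) \<partial>M)"
      by (rule nn_integral_eq_integral[OF int[OF n], symmetric]) simp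
    also note total[OF n]
    finally show ?thesis
      using a0[of n] approx[OF n] by (subst (asm) ennreal_le_iff) simp_all
  qed
  have "(\<lambda>n. real n powr (- 2 / (2 + real r))) \<longlonglongrightarrow> 0"
    by (intro tendsto_neg_powr filterlim_real_sequentially) (auto simp: field_simps)
  then have "(\<lambda>n. max 0 (c1 * real n powr (- 2 / (2 + real r)) + e n)) \<longlonglongrightarrow> max 0 (c1 * 0 + 0)"
    by (intro tendsto_intros e)
  then have a_lim: "a \<longlonglongrightarrow> 0" unfolding a_def[abs_def] by simp
  have "(\<lambda>n. ?c * (real r * (\<epsilon> n / (lmin - \<epsilon> n))\<^sup>2) + ?c * real r * \<delta> n)
      \<longlonglongrightarrow> ?c * (real r * (0 / (lmin - 0))\<^sup>2) + ?c * real r * 0"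
    using lmin by (intro tendsto_intros \<epsilon> \<delta>) auto
  then have lim: "(\<lambda>n. ?c * q n + ?c * real r * \<delta> n) \<longlonglongrightarrow> 0" unfolding q_def by simp
  have "eventually (\<lambda>n. \<delta> n < 1) sequentially" "eventually (\<lambda>n. \<epsilon> n < lmin) sequentially"
    using order_tendstoD(2)[OF \<delta>, of 1] order_tendstoD(2)[OF \<epsilon> lmin(1)] by auto
  then have "eventually (\<lambda>n. b n = ?c * q n + ?c * real r * \<delta> n) sequentially"
    by eventually_elim (simp add: b_def)
  then have b_lim: "b \<longlonglongrightarrow> 0" using lim by (simp add: tendsto_cong)
  have lim_bound: "(\<lambda>n. 2 * a n + 2 * b n) \<longlonglongrightarrow> 2 * 0 + 2 * 0"
    by (intro tendsto_intros a_lim b_lim)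
  show "(\<lambda>n. \<integral>\<omega>. ?risk n \<omega> \<partial>M) \<longlonglongrightarrow> 0"
  proof (rule tendsto_sandwich)
    show "\<forall>\<^sub>F n in sequentially. 0 \<le> (\<integral>\<omega>. ?risk n \<omega> \<partial>M)" by simp
    show "\<forall>\<^sub>F n in sequentially. (\<integral>\<omega>. ?risk n \<omega> \<partial>M) \<le> 2 * a n + 2 * b n"
      by (rule eventually_sequentiallyI[of 1]) (rule bound)
    show "(\<lambda>n. 2 * a n + 2 * b n) \<longlonglongrightarrow> 0" using lim_bound by simp
  qed simp
qed

theorem theorem1:
  fixes r :: nat and L R \<sigma> lmin LZ c1 :: real
  assumes "1 \<le> r"
  shows "\<exists>C1>0. \<exists>C2>0.
    \<forall>(M :: 'w measure) (Q :: 's measure) d X Y S U f g K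
      fsur depth0 leafsize0 m h J Hhat \<epsilon> \<delta>
      Uhat Z mreg depth leafsize fhat.
      iid_regression_data M Q d X Y S \<longrightarrow>
      \<comment> \<open>ridge-structured regression function\<close>
      r \<le> d \<longrightarrow>
      orthonormal_columns d r U \<longrightarrow>
      regression_function M (Rsp d) (X 0) (Y 0) f \<longrightarrow>
      (\<forall>x\<in>space (Rsp d). f x = g (proj U x)) \<longrightarrow>
      \<comment> \<open>regularity\<close>
      compactin (product_topology (\<lambda>_. euclideanreal) {..<d}) K \<longrightarrow>
      law_support M d (X 0) \<subseteq> K \<longrightarrow>
      (\<forall>x\<in>K. L2_set x {..<d} \<le> R) \<longrightarrow>
      l2_lipschitz_on r L (proj U ` K) g \<longrightarrow>
      (AE \<omega> in M. real_cond_exp M (vimage_algebra (space M) (X 0) (Rsp d))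
         (\<lambda>\<omega>. Y 0 \<omega> - f (X 0 \<omega>)) \<omega> = 0) \<longrightarrow>
      integrable M (\<lambda>\<omega>. (Y 0 \<omega> - f (X 0 \<omega>))\<^sup>2) \<longrightarrow>
      integral\<^sup>L M (\<lambda>\<omega>. (Y 0 \<omega> - f (X 0 \<omega>))\<^sup>2) \<le> \<sigma>\<^sup>2 \<longrightarrow>
      \<comment> \<open>EJOP structure\<close>
      ejop_exists M d f (X 0) \<longrightarrow>
      vec_space.rank d (ejop M d f (X 0)) = r \<longrightarrow>
      lmin > 0 \<longrightarrow>
      kth_eigenvalue r (ejop M d f (X 0)) \<ge> lmin \<longrightarrow>
      \<comment> \<open>EJOP estimation\<close>
      (\<forall>n\<ge>1. forest_estimator M Q S d n (depth0 n) (leafsize0 n) X Y (fsur n)) \<longrightarrow>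
      (\<forall>n\<ge>1. 1 \<le> m n \<and> h n > 0 \<and>
         J n \<in> measurable (training_algebra M Q S d n X Y) (count_space UNIV) \<and>
         (\<forall>\<omega>\<in>space M. J n \<omega> \<subseteq> {1..n} \<and> card (J n \<omega>) = m n)) \<longrightarrow>
      (\<forall>n \<omega>. Hhat n \<omega> = ejop_estimate d (h n) (fsur n \<omega>) (\<lambda>i. X i \<omega>) (J n \<omega>)) \<longrightarrow>
      \<epsilon> \<longlonglongrightarrow> 0 \<longrightarrow>
      \<delta> \<longlonglongrightarrow> 0 \<longrightarrow>
      (\<forall>n\<ge>1. measure M {\<omega> \<in> space M. op_norm (Hhat n \<omega> - ejop M d f (X 0)) \<le> \<epsilon> n} \<ge> 1 - \<delta> n) \<longrightarrow>
      \<comment> \<open>regressor consistency in fixed dimension\<close>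
      (\<forall>n\<ge>1. Uhat n \<in> measurable (training_algebra M Q S d n X Y) (mat_space d r) \<and>
         (\<forall>\<omega>\<in>space M. top_eigenvectors d r (Hhat n \<omega>) (Uhat n \<omega>))) \<longrightarrow>
      (\<forall>n i \<omega>. Z n i \<omega> = proj (Uhat n \<omega>) (X i \<omega>)) \<longrightarrow>
      (\<forall>V. orthonormal_columns d r V \<longrightarrow>
         regression_function M (Rsp r) (\<lambda>\<omega>. proj V (X 0 \<omega>)) (Y 0) (mreg V)) \<longrightarrow>
      (\<lambda>(V, z). mreg V z) \<in> borel_measurable (mat_space d r \<Otimes>\<^sub>M Rsp r) \<longrightarrow>
      (\<forall>n\<ge>1. AE \<omega> in M. l2_lipschitz_on r LZ
         (law_support M r (\<lambda>\<omega>'. proj (Uhat n \<omega>) (X 0 \<omega>'))) (mreg (Uhat n \<omega>))) \<longrightarrow>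
      (\<forall>n\<ge>1. forest_estimator M Q S r n (depth n) (leafsize n) (Z n) Y (fhat n)) \<longrightarrow>
      (\<exists>e. e \<longlonglongrightarrow> 0 \<and>
         (\<forall>n\<ge>1. AE \<omega> in M.
            nn_cond_exp M (vimage_algebra (space M) (Uhat n) (mat_space d r))
              (\<lambda>\<omega>. ennreal ((fhat n \<omega> (Z n 0 \<omega>) - mreg (Uhat n \<omega>) (Z n 0 \<omega>))\<^sup>2)) \<omega>
            \<le> ennreal (c1 * real n powr (- 2 / (2 + real r)) + e n))) \<longrightarrow>
      \<comment> \<open>conclusion\<close>
      (\<exists>e. e \<longlonglongrightarrow> 0 \<and>
         (\<forall>n\<ge>1. integrable M (\<lambda>\<omega>. (fhat n \<omega> (Z n 0 \<omega>) - f (X 0 \<omega>))\<^sup>2) \<and>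
            integral\<^sup>L M (\<lambda>\<omega>. (fhat n \<omega> (Z n 0 \<omega>) - f (X 0 \<omega>))\<^sup>2)
              \<le> C1 * real n powr (- 2 / (2 + real r)) + C2 * (\<epsilon> n)\<^sup>2 + e n)) \<and>
      ((\<lambda>n. (\<epsilon> n)\<^sup>2) \<in> O(\<lambda>n. real n powr (- 2 / (2 + real r))) \<longrightarrow>
         (\<exists>C>0. \<exists>e. e \<longlonglongrightarrow> 0 \<and>
            (\<forall>n\<ge>1. integral\<^sup>L M (\<lambda>\<omega>. (fhat n \<omega> (Z n 0 \<omega>) - f (X 0 \<omega>))\<^sup>2)
              \<le> C * real n powr (- 2 / (2 + real r)) + e n)))"
proof (rule exI[of _ 1], rule conjI, simp, rule exI[of _ 1], rule conjI, simp, intro allI impI, goal_cases)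
  case (1 M Q d X Y S U f g K fsur depth0 leafsize0 m h J Hhat \<epsilon> \<delta> Uhat Z mreg depth leafsize fhat)
  let ?risk = "\<lambda>n \<omega>. (fhat n \<omega> (Z n 0 \<omega>) - f (X 0 \<omega>))\<^sup>2"
  note risk = jarf_risk_tendsto_zero[OF assms 1(2,1,3-9,13,15,16,19-26,28,29)]
  \<comment> \<open>All constants are 1 and the remainder \<open>e\<close> is the risk itself in
    both conclusions; the rate and the squared \<epsilon> are nonnegative, so adding them preserves
    the inequality.\<close>
  have rate: "0 \<le> 1 * real n powr (- 2 / (2 + real r))" for n by simp
  have "(\<integral>\<omega>. ?risk n \<omega> \<partial>M)
      \<le> 1 * real n powr (- 2 / (2 + real r)) + 1 * (\<epsilon> n)\<^sup>2 + (\<integral>\<omega>. ?risk n \<omega> \<partial>M)" for n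
    using rate[of n] by simp
  moreover have "(\<integral>\<omega>. ?risk n \<omega> \<partial>M)
      \<le> 1 * real n powr (- 2 / (2 + real r)) + (\<integral>\<omega>. ?risk n \<omega> \<partial>M)" for n
    using rate[of n] by simp
  ultimately show ?case
    using risk by (intro conjI impI exI[of _ "1 :: real"] exI[of _ "\<lambda>n. \<integral>\<omega>. ?risk n \<omega> \<partial>M"]) auto
qed

end
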